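(* There is a polynomial-time algorithm that, given an instance $G$ of $(1,2)$-ATSP, outputs a directed Hamiltonian cycle of $G$ of cost at most $\tfrac{3}{2}\,\mathrm{Opt}_{\mathrm{SER}^+}(G)$.
   Context: An instance $G$ of $(1,2)$-ATSP is a complete directed graph (with both arcs $(u,v)$ and $(v,u)$ for all distinct $u,v$, no loops) on a finite vertex set $V(G)$ with $|V(G)|\ge 2$, with arc costs $\mathrm{cost}:E(G)\to\{1,2\}$; the cost of a directed Hamiltonian cycle (tour) is the sum of its arc costs. For $S\subseteq V(G)$ let $\delta^+(S)$ (resp. $\delta^-(S)$) be the set of arcs leaving (resp. entering) $S$, and $x(F)=\sum_{e\in F}x_e$. $\mathrm{SER}(G)$ is the polytope of $x\in\mathbb{R}^{E(G)}$ with $x(\delta^-(v))=x(\delta^+(v))=1$ for all $v\in V(G)$, $x(\delta^-(S))\ge1$ and $x(\delta^+(S))\ge 1$ for all $\emptyset\ne S\subsetneq V(G)$, and $x\ge0$; $\mathrm{Opt}_{\mathrm{SER}}(G)$ is the minimum of $\sum_e\mathrm{cost}(e)x_e$ over it. $\mathrm{SER}^+(G)$ is $\mathrm{SER}(G)$ with the additional constraint $\sum_e\mathrm{cost}(e)x_e\ge\lceil\mathrm{Opt}_{\mathrm{SER}}(G)\rceil$, and $\mathrm{Opt}_{\mathrm{SER}^+}(G)$ is the minimum of $\sum_e\mathrm{cost}(e)x_e$ over $\mathrm{SER}^+(G)$. *)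

theory Defs
  imports Complex_Main "HOL-Library.Log_Nat" "HOL-Computational_Algebra.Polynomial"
begin

section \<open>Instances, tours and the linear relaxations\<close>

definition arcs :: "'v set \<Rightarrow> ('v \<times> 'v) set" where
  "arcs V = {(u, v). u \<in> V \<and> v \<in> V \<and> u \<noteq> v}"

definition atsp12_instance :: "'v set \<Rightarrow> ('v \<times> 'v \<Rightarrow> nat) \<Rightarrow> bool" where
  "atsp12_instance V c \<longleftrightarrow> finite V \<and> card V \<ge> 2 \<and> (\<forall>e \<in> arcs V. c e \<in> {1, 2})"

text \<open>A directed Hamiltonian cycle is given by listing every vertex once, in cyclic order;
  rotating the list by one pairs each vertex with its successor on the cycle.\<close>

definition hamiltonian_cycle :: "'v set \<Rightarrow> 'v list \<Rightarrow> bool" where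
  "hamiltonian_cycle V vs \<longleftrightarrow> distinct vs \<and> set vs = V"

definition tour_arcs :: "'v list \<Rightarrow> ('v \<times> 'v) list" where
  "tour_arcs vs = zip vs (rotate1 vs)"

definition tour_cost :: "('v \<times> 'v \<Rightarrow> nat) \<Rightarrow> 'v list \<Rightarrow> nat" where
  "tour_cost c vs = (\<Sum>e \<leftarrow> tour_arcs vs. c e)"

definition delta_out :: "'v set \<Rightarrow> 'v set \<Rightarrow> ('v \<times> 'v) set" where
  "delta_out V S = {(u, v) \<in> arcs V. u \<in> S \<and> v \<notin> S}"

definition delta_in :: "'v set \<Rightarrow> 'v set \<Rightarrow> ('v \<times> 'v) set" where
  "delta_in V S = {(u, v) \<in> arcs V. u \<notin> S \<and> v \<in> S}"

text \<open>Vectors indexed by the arcs are functions on all pairs that vanish outside the arcs.\<close>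

definition SER :: "'v set \<Rightarrow> ('v \<times> 'v \<Rightarrow> real) set" where
  "SER V = {x. (\<forall>e. e \<notin> arcs V \<longrightarrow> x e = 0)
     \<and> (\<forall>v \<in> V. sum x (delta_in V {v}) = 1 \<and> sum x (delta_out V {v}) = 1)
     \<and> (\<forall>S. S \<noteq> {} \<and> S \<subset> V \<longrightarrow> sum x (delta_in V S) \<ge> 1 \<and> sum x (delta_out V S) \<ge> 1)
     \<and> (\<forall>e \<in> arcs V. x e \<ge> 0)}"

definition lp_cost :: "'v set \<Rightarrow> ('v \<times> 'v \<Rightarrow> nat) \<Rightarrow> ('v \<times> 'v \<Rightarrow> real) \<Rightarrow> real" where
  "lp_cost V c x = (\<Sum>e \<in> arcs V. real (c e) * x e)"

text \<open>On an instance, both feasible regions are compact and nonempty (each contains the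
  indicator vector of every tour), so these infima are attained, i.e. they are minima.\<close>

definition Opt_SER :: "'v set \<Rightarrow> ('v \<times> 'v \<Rightarrow> nat) \<Rightarrow> real" where
  "Opt_SER V c = (INF x \<in> SER V. lp_cost V c x)"

definition SER_plus :: "'v set \<Rightarrow> ('v \<times> 'v \<Rightarrow> nat) \<Rightarrow> ('v \<times> 'v \<Rightarrow> real) set" where
  "SER_plus V c = {x \<in> SER V. lp_cost V c x \<ge> real_of_int \<lceil>Opt_SER V c\<rceil>}"

definition Opt_SER_plus :: "'v set \<Rightarrow> ('v \<times> 'v \<Rightarrow> nat) \<Rightarrow> real" where
  "Opt_SER_plus V c = (INF x \<in> SER_plus V c. lp_cost V c x)"


section \<open>Algorithms: a random access machine with logarithmic cost\<close>

text \<open>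
  Algorithms are structured programs over finitely many named, unbounded arrays of natural
  numbers with indirect addressing (scalars are cells with a constant index). Running time is
  measured by the logarithmic cost criterion: every evaluation of a subexpression is charged
  the bit length of its value plus one, addresses and results of multiplications included, so
  polynomial time here agrees with polynomial time on Turing machines.
\<close>

type_synonym state = "string \<Rightarrow> nat \<Rightarrow> nat"

datatype exp =
    Lit nat
  | Cell string exp
  | Plus exp exp
  | Minus exp exp
  | Times exp exp
  | Less exp exp
  | Eq exp exp

fun val :: "exp \<Rightarrow> state \<Rightarrow> nat" where
  "val (Lit k) s = k"
| "val (Cell a e) s = s a (val e s)"
| "val (Plus e f) s = val e s + val f s"
| "val (Minus e f) s = val e s - val f s"
| "val (Times e f) s = val e s * val f s"
| "val (Less e f) s = (if val e s < val f s then 1 else 0)"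
| "val (Eq e f) s = (if val e s = val f s then 1 else 0)"

text \<open>The number of binary digits of \<open>k\<close> is \<open>floorlog 2 k\<close>.\<close>

definition charge :: "nat \<Rightarrow> nat" where
  "charge k = 1 + floorlog 2 k"

fun val_time :: "exp \<Rightarrow> state \<Rightarrow> nat" where
  "val_time (Lit k) s = charge k"
| "val_time (Cell a e) s = val_time e s + charge (val (Cell a e) s)"
| "val_time (Plus e f) s = val_time e s + val_time f s + charge (val (Plus e f) s)"
| "val_time (Minus e f) s = val_time e s + val_time f s + charge (val (Minus e f) s)"
| "val_time (Times e f) s = val_time e s + val_time f s + charge (val (Times e f) s)"
| "val_time (Less e f) s = val_time e s + val_time f s + charge (val (Less e f) s)"
| "val_time (Eq e f) s = val_time e s + val_time f s + charge (val (Eq e f) s)"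

datatype com =
    Skip
  | Store string exp exp
  | Seq com com
  | Cond exp com com
  | While exp com

text \<open>\<open>exec p s t s'\<close>: started in \<open>s\<close>, program \<open>p\<close> halts in \<open>s'\<close> after time \<open>t\<close>.
  \<open>Store a i e\<close> is the assignment \<open>a[i] := e\<close>; nonzero values count as true.\<close>

inductive exec :: "com \<Rightarrow> state \<Rightarrow> nat \<Rightarrow> state \<Rightarrow> bool" where
  Skip: "exec Skip s 1 s"
| Store: "exec (Store a i e) s (1 + val_time i s + val_time e s)
     (s(a := (s a)(val i s := val e s)))"
| Seq: "exec p s t s' \<Longrightarrow> exec q s' t' s'' \<Longrightarrow> exec (Seq p q) s (t + t') s''"
| CondTrue: "val b s \<noteq> 0 \<Longrightarrow> exec p s t s' \<Longrightarrow> exec (Cond b p q) s (1 + val_time b s + t) s'"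
| CondFalse: "val b s = 0 \<Longrightarrow> exec q s t s' \<Longrightarrow> exec (Cond b p q) s (1 + val_time b s + t) s'"
| WhileFalse: "val b s = 0 \<Longrightarrow> exec (While b p) s (1 + val_time b s) s"
| WhileTrue: "val b s \<noteq> 0 \<Longrightarrow> exec p s t s' \<Longrightarrow> exec (While b p) s' t' s''
     \<Longrightarrow> exec (While b p) s (1 + val_time b s + t + t') s''"

lemma exec_deterministic:
  "exec p s t s' \<Longrightarrow> exec p s u s'' \<Longrightarrow> t = u \<and> s' = s''"
proof (induction arbitrary: u s'' rule: exec.induct)
  case (Skip s)
  from Skip.prems show ?case by cases simp
next
  case (Store a i e s)
  from Store.prems show ?case by cases simp
next
  case (Seq p s t s' q t' s2)
  from Seq.prems show ?case by cases (blast dest: Seq.IH)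
next
  case (CondTrue b s p t s' q)
  from CondTrue.prems CondTrue.hyps show ?case by cases (blast dest: CondTrue.IH)+
next
  case (CondFalse b s q t s' p)
  from CondFalse.prems CondFalse.hyps show ?case by cases (blast dest: CondFalse.IH)+
next
  case (WhileFalse b s p)
  from WhileFalse.prems WhileFalse.hyps show ?case by cases simp_all
next
  case (WhileTrue b s p t s' t' s2)
  from WhileTrue.prems show ?case
  proof cases
    case WhileFalse
    with WhileTrue.hyps show ?thesis by simp
  next
    case (WhileTrue v s3 v')
    with \<open>\<And>u s''. exec p s u s'' \<Longrightarrow> t = u \<and> s' = s''\<close> have "t = v \<and> s' = s3" by blast
    with WhileTrue \<open>\<And>u s''. exec (While b p) s' u s'' \<Longrightarrow> t' = u \<and> s2 = s''\<close>
    show ?thesis by blast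
  qed
qed

text \<open>An instance on the vertices \<open>0, \<dots>, n - 1\<close> is presented as \<open>n\<close> together with its cost matrix
  in row-major order; all other cells are zero, including those on the diagonal. A list of \<open>n\<close>
  vertices is read off the array \<open>tour\<close>.\<close>

definition input_state :: "nat \<Rightarrow> (nat \<times> nat \<Rightarrow> nat) \<Rightarrow> state" where
  "input_state n c = (\<lambda>a i.
     if a = ''n'' \<and> i = 0 then n
     else if a = ''cost'' \<and> i < n * n \<and> i div n \<noteq> i mod n then c (i div n, i mod n)
     else 0)"

definition output_tour :: "nat \<Rightarrow> state \<Rightarrow> nat list" where
  "output_tour n s = map (s ''tour'') [0..<n]"

end

theory Submission
  imports Defs
begin

text \<open>
  Call an arc cheap if it costs 1. Build vertex-disjoint cheap paths one at a time: extend the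
  current path at either end by an unused vertex; if it closes up to a cheap cycle, extend it at
  the end of any of its rotations; when stuck, start a new path. Concatenating the paths gives a
  tour of cost at most the sum of \<open>|P| + 1\<close> over all paths \<open>P\<close>. Let \<open>N\<close> be the set of paths that
  do not close up, \<open>B\<close> their first vertices and \<open>A\<close> their vertices other than the last ones. Since
  the paths are stuck, cheap arcs into \<open>B\<close> start in \<open>A\<close>, so at least \<open>|B| - |A|\<close> units of any
  fractional solution use expensive arcs. Hence the linear program costs at least
  \<open>n + |B| - |A|\<close>, and also at least \<open>n\<close>; as a path that closes up has at least two vertices,
  averaging these bounds with weights 1/3 and 2/3 gives the factor 3/2.

  Polynomial time comes for free from the shape of the program: all loops run \<open>n\<close> times and
  stored values grow by a constant only.
\<close>

section \<open>Loop programs run in polynomial time\<close>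

datatype prog =
    Nop
  | Assign string exp exp
  | Then prog prog
  | If exp prog prog
  | For string prog

abbreviation var :: "string \<Rightarrow> exp" where
  "var x \<equiv> Cell x (Lit 0)"

definition set_var :: "string \<Rightarrow> nat \<Rightarrow> state \<Rightarrow> state" where
  "set_var x k s = s(x := (s x)(0 := k))"

fun compile :: "prog \<Rightarrow> com" where
  "compile Nop = Skip"
| "compile (Assign a i e) = Store a i e"
| "compile (Then p q) = Seq (compile p) (compile q)"
| "compile (If b p q) = Cond b (compile p) (compile q)"
| "compile (For x p) = Seq (Store x (Lit 0) (Lit 0))
     (While (Less (var x) (var ''n''))
       (Seq (compile p) (Store x (Lit 0) (Plus (var x) (Lit 1)))))"

text \<open>The number of rounds is the value of \<open>n\<close> on entry, whereas the compiled
  loop rereads \<open>n\<close> before every round. The two agree under \<open>wf_prog\<close>,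
  which keeps \<open>n\<close> and the loop counters out of reach of the body.\<close>

fun den :: "prog \<Rightarrow> state \<Rightarrow> state" where
  "den Nop s = s"
| "den (Assign a i e) s = s(a := (s a)(val i s := val e s))"
| "den (Then p q) s = den q (den p s)"
| "den (If b p q) s = (if val b s \<noteq> 0 then den p s else den q s)"
| "den (For x p) s =
     ((\<lambda>s. set_var x (Suc (den p s x 0)) (den p s)) ^^ s ''n'' 0) (set_var x 0 s)"

fun assigned :: "prog \<Rightarrow> string set" where
  "assigned Nop = {}"
| "assigned (Assign a i e) = {a}"
| "assigned (Then p q) = assigned p \<union> assigned q"
| "assigned (If b p q) = assigned p \<union> assigned q"
| "assigned (For x p) = insert x (assigned p)"

text \<open>Stored values may exceed the largest cell only by a constant, so that cells stay
  polynomially bounded over polynomially many steps.\<close>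

fun tame :: "exp \<Rightarrow> bool" where
  "tame (Plus e f) = (tame e \<and> (\<exists>k. f = Lit k))"
| "tame (Minus e f) = tame e"
| "tame (Times e f) = False"
| "tame e = True"

text \<open>\<open>tame\<close> restricts stored values only. Addresses and tests may multiply: the
  row-major index into the cost matrix and the conjunctions of tests do.\<close>

fun wf_prog :: "prog \<Rightarrow> bool" where
  "wf_prog Nop = True"
| "wf_prog (Assign a i e) = (a \<noteq> ''n'' \<and> tame e)"
| "wf_prog (Then p q) = (wf_prog p \<and> wf_prog q)"
| "wf_prog (If b p q) = (wf_prog p \<and> wf_prog q)"
| "wf_prog (For x p) = (x \<noteq> ''n'' \<and> x \<notin> assigned p \<and> wf_prog p)"

section \<open>Polynomial bounds for expressions\<close>

definition bounded_by :: "nat \<Rightarrow> state \<Rightarrow> bool" where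
  "bounded_by B s \<longleftrightarrow> (\<forall>a i. s a i \<le> B)"

lemma bounded_by_mono: "bounded_by B s \<Longrightarrow> B \<le> C \<Longrightarrow> bounded_by C s"
  unfolding bounded_by_def by (meson le_trans)

lemma poly_nat_mono: "x \<le> y \<Longrightarrow> poly p x \<le> poly p (y :: nat)"
  by (induction p) (auto intro: add_mono mult_mono)

lemma charge_le: "charge k \<le> k + 2"
proof (cases "k = 0")
  case True
  then show ?thesis by (simp add: charge_def floorlog_def)
next
  case False
  have "floorlog 2 k \<le> k"
    using less_exp[of k] by (intro floorlog_leI) auto
  then show ?thesis by (simp add: charge_def)
qed

text \<open>Bit lengths are estimated by the values themselves, via \<open>charge_le\<close>. A cell
  has value at most \<open>B\<close> whatever its address, so nested addressing does not compound;
  products are bounded by products of polynomials.\<close>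

lemma exp_poly_bound:
  "\<exists>q. \<forall>s B. bounded_by B s \<longrightarrow> val e s \<le> poly q B \<and> val_time e s \<le> poly q B"
proof (induction e)
  case (Lit k)
  show ?case by (rule exI[of _ "[:k + charge k:]"]) simp
next
  case (Cell a e)
  then obtain q where q: "\<forall>s B. bounded_by B s \<longrightarrow> val e s \<le> poly q B \<and> val_time e s \<le> poly q B"
    by blast
  show ?case
  proof (rule exI[of _ "q + [:2, 1:]"], intro allI impI)
    fix s B assume s: "bounded_by B s"
    then have "s a (val e s) \<le> B" by (simp add: bounded_by_def)
    with q[rule_format, OF s] charge_le[of "s a (val e s)"]
    show "val (Cell a e) s \<le> poly (q + [:2, 1:]) B
        \<and> val_time (Cell a e) s \<le> poly (q + [:2, 1:]) B"
      by simp
  qed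
next
  case (Plus e f)
  then obtain q r where q: "\<forall>s B. bounded_by B s \<longrightarrow> val e s \<le> poly q B \<and> val_time e s \<le> poly q B"
    and r: "\<forall>s B. bounded_by B s \<longrightarrow> val f s \<le> poly r B \<and> val_time f s \<le> poly r B"
    by blast
  show ?case
  proof (rule exI[of _ "q + r + q + r + [:2:]"], intro allI impI)
    fix s B assume s: "bounded_by B s"
    show "val (Plus e f) s \<le> poly (q + r + q + r + [:2:]) B
        \<and> val_time (Plus e f) s \<le> poly (q + r + q + r + [:2:]) B"
      using q[rule_format, OF s] r[rule_format, OF s] charge_le[of "val e s + val f s"] by simp
  qed
next
  case (Minus e f)
  then obtain q r where q: "\<forall>s B. bounded_by B s \<longrightarrow> val e s \<le> poly q B \<and> val_time e s \<le> poly q B"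
    and r: "\<forall>s B. bounded_by B s \<longrightarrow> val f s \<le> poly r B \<and> val_time f s \<le> poly r B"
    by blast
  show ?case
  proof (rule exI[of _ "q + r + q + r + [:2:]"], intro allI impI)
    fix s B assume s: "bounded_by B s"
    show "val (Minus e f) s \<le> poly (q + r + q + r + [:2:]) B
        \<and> val_time (Minus e f) s \<le> poly (q + r + q + r + [:2:]) B"
      using q[rule_format, OF s] r[rule_format, OF s] charge_le[of "val e s - val f s"]
      by (simp, linarith)
  qed
next
  case (Times e f)
  then obtain q r where q: "\<forall>s B. bounded_by B s \<longrightarrow> val e s \<le> poly q B \<and> val_time e s \<le> poly q B"
    and r: "\<forall>s B. bounded_by B s \<longrightarrow> val f s \<le> poly r B \<and> val_time f s \<le> poly r B"
    by blast
  show ?case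
  proof (rule exI[of _ "q + r + q * r + [:2:]"], intro allI impI)
    fix s B assume s: "bounded_by B s"
    have "val e s * val f s \<le> poly q B * poly r B"
      using q[rule_format, OF s] r[rule_format, OF s] by (intro mult_mono) auto
    then show "val (Times e f) s \<le> poly (q + r + q * r + [:2:]) B
        \<and> val_time (Times e f) s \<le> poly (q + r + q * r + [:2:]) B"
      using q[rule_format, OF s] r[rule_format, OF s] charge_le[of "val e s * val f s"]
      by simp
  qed
next
  case (Less e f)
  then obtain q r where q: "\<forall>s B. bounded_by B s \<longrightarrow> val e s \<le> poly q B \<and> val_time e s \<le> poly q B"
    and r: "\<forall>s B. bounded_by B s \<longrightarrow> val f s \<le> poly r B \<and> val_time f s \<le> poly r B"
    by blast
  show ?case
  proof (rule exI[of _ "q + r + [:3:]"], intro allI impI)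
    fix s B assume s: "bounded_by B s"
    show "val (Less e f) s \<le> poly (q + r + [:3:]) B
        \<and> val_time (Less e f) s \<le> poly (q + r + [:3:]) B"
      using q[rule_format, OF s] r[rule_format, OF s] charge_le[of 1] charge_le[of 0] by simp
  qed
next
  case (Eq e f)
  then obtain q r where q: "\<forall>s B. bounded_by B s \<longrightarrow> val e s \<le> poly q B \<and> val_time e s \<le> poly q B"
    and r: "\<forall>s B. bounded_by B s \<longrightarrow> val f s \<le> poly r B \<and> val_time f s \<le> poly r B"
    by blast
  show ?case
  proof (rule exI[of _ "q + r + [:3:]"], intro allI impI)
    fix s B assume s: "bounded_by B s"
    show "val (Eq e f) s \<le> poly (q + r + [:3:]) B
        \<and> val_time (Eq e f) s \<le> poly (q + r + [:3:]) B"
      using q[rule_format, OF s] r[rule_format, OF s] charge_le[of 1] charge_le[of 0] by simp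
  qed
qed

lemma tame_bound:
  "tame e \<Longrightarrow> \<exists>g. \<forall>s B. bounded_by B s \<longrightarrow> val e s \<le> B + g"
proof (induction e)
  case (Plus e f)
  then obtain g k where "f = Lit k" "\<forall>s B. bounded_by B s \<longrightarrow> val e s \<le> B + g" by auto
  then show ?case by (intro exI[of _ "g + k"]) (auto simp: add.assoc[symmetric])
next
  case (Minus e f)
  then obtain g where "\<forall>s B. bounded_by B s \<longrightarrow> val e s \<le> B + g" by auto
  then show ?case by (intro exI[of _ g]) (auto intro: le_trans[OF diff_le_self])
next
  case (Lit k)
  then show ?case by (intro exI[of _ k]) auto
next
  case (Cell a e)
  then show ?case by (intro exI[of _ 0]) (auto simp: bounded_by_def)
next
  case (Less e f)
  then show ?case by (intro exI[of _ 1]) auto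
next
  case (Eq e f)
  then show ?case by (intro exI[of _ 1]) auto
qed simp

section \<open>Semantics and running time of compiled loops\<close>

lemma den_unassigned: "a \<notin> assigned p \<Longrightarrow> den p s a = s a"
proof (induction p arbitrary: s)
  case (For x p)
  have "((\<lambda>s. set_var x (Suc (den p s x 0)) (den p s)) ^^ k) (set_var x 0 s) a = s a" for k
    using For by (induction k) (auto simp: set_var_def)
  then show ?case by simp
qed auto

lemma wf_prog_n: "wf_prog p \<Longrightarrow> ''n'' \<notin> assigned p"
  by (induction p) auto

lemma den_n: "wf_prog p \<Longrightarrow> den p s ''n'' = s ''n''"
  by (simp add: den_unassigned wf_prog_n)

text \<open>\<open>S\<close> is the trajectory of the loop; \<open>C\<close> bounds one run of the
  body as well as one test. There are \<open>k\<close> body runs and \<open>k + 1\<close> tests,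
  hence the factor.\<close>

lemma exec_While:
  assumes "\<And>j. j < k \<Longrightarrow> val b (S j) \<noteq> 0 \<and> (\<exists>t \<le> C. exec p (S j) t (S (Suc j)))"
    and "val b (S k) = 0"
    and "\<And>j. j \<le> k \<Longrightarrow> 1 + val_time b (S j) \<le> C"
  shows "\<exists>t \<le> (2 * k + 1) * C. exec (While b p) (S 0) t (S k)"
  using assms
proof (induction k arbitrary: S)
  case 0
  then show ?case using exec.WhileFalse[of b "S 0" p] by auto
next
  case (Suc k)
  have "\<exists>t \<le> (2 * k + 1) * C. exec (While b p) ((\<lambda>j. S (Suc j)) 0) t ((\<lambda>j. S (Suc j)) k)"
    by (rule Suc.IH) (use Suc.prems in auto)
  then obtain t' where t': "t' \<le> (2 * k + 1) * C" "exec (While b p) (S 1) t' (S (Suc k))"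
    by auto
  obtain t where t: "t \<le> C" "exec p (S 0) t (S 1)" and b: "val b (S 0) \<noteq> 0"
    using Suc.prems(1)[of 0] by auto
  have "exec (While b p) (S 0) (1 + val_time b (S 0) + t + t') (S (Suc k))"
    using exec.WhileTrue b t(2) t'(2) by blast
  moreover have "1 + val_time b (S 0) + t + t' \<le> (2 * Suc k + 1) * C"
    using Suc.prems(3)[of 0] t(1) t'(1) by (simp add: algebra_simps)
  ultimately show ?case by blast
qed

text \<open>Together these facts make the guard of the compiled loop true in rounds \<open>0\<close>
  to \<open>n - 1\<close> and false afterwards.\<close>

lemma den_For_iterate:
  fixes p :: prog and x :: string
  defines "F \<equiv> \<lambda>s. set_var x (Suc (den p s x 0)) (den p s)"
  assumes "wf_prog (For x p)"
  shows "(F ^^ j) (set_var x 0 s) x 0 = j" "(F ^^ j) (set_var x 0 s) ''n'' = s ''n''"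
proof -
  show "(F ^^ j) (set_var x 0 s) x 0 = j"
    using assms by (induction j) (auto simp: set_var_def den_unassigned)
  show "(F ^^ j) (set_var x 0 s) ''n'' = s ''n''"
    using assms by (induction j) (auto simp: set_var_def den_n)
qed

text \<open>The induction carries two kinds of bound. Time is polynomial in the cell bound
  \<open>B\<close>, but the growth of cells is additive and depends on \<open>n\<close> alone. As
  \<open>n\<close> never changes, the increments of the rounds of a loop just add up; a growth
  polynomial in \<open>B\<close> would be iterated instead.\<close>

theorem compile_poly_time:
  assumes "wf_prog p"
  shows "\<exists>q g. \<forall>s B. bounded_by B s \<longrightarrow>
    (\<exists>t \<le> poly q B. exec (compile p) s t (den p s)) \<and>
    bounded_by (B + poly g (s ''n'' 0)) (den p s)"
  using assms
proof (induction p)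
  case Nop
  have "\<exists>t \<le> 1. exec Skip s t s" for s using exec.Skip by blast
  then show ?case by (intro exI[of _ "[:1:]"] exI[of _ 0]) simp
next
  case (Assign a i e)
  obtain q where q: "\<forall>s B. bounded_by B s \<longrightarrow> val e s \<le> poly q B \<and> val_time e s \<le> poly q B"
    using exp_poly_bound by blast
  obtain r where r: "\<forall>s B. bounded_by B s \<longrightarrow> val i s \<le> poly r B \<and> val_time i s \<le> poly r B"
    using exp_poly_bound by blast
  obtain g where g: "\<forall>s B. bounded_by B s \<longrightarrow> val e s \<le> B + g"
    using tame_bound[of e] Assign by auto
  show ?case
  proof (rule exI[of _ "[:1:] + r + q"], rule exI[of _ "[:g:]"], intro allI impI conjI)
    fix s B assume s: "bounded_by B s"
    have "1 + val_time i s + val_time e s \<le> poly ([:1:] + r + q) B"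
      using q[rule_format, OF s] r[rule_format, OF s] by simp
    then show "\<exists>t \<le> poly ([:1:] + r + q) B.
        exec (compile (Assign a i e)) s t (den (Assign a i e) s)"
      using exec.Store by auto
    show "bounded_by (B + poly [:g:] (s ''n'' 0)) (den (Assign a i e) s)"
      using s g[rule_format, OF s] by (auto simp: bounded_by_def trans_le_add1)
  qed
next
  case (Then p1 p2)
  obtain q1 g1 where 1: "\<And>s B. bounded_by B s \<Longrightarrow>
      (\<exists>t \<le> poly q1 B. exec (compile p1) s t (den p1 s)) \<and>
      bounded_by (B + poly g1 (s ''n'' 0)) (den p1 s)" using Then by auto
  obtain q2 g2 where 2: "\<And>s B. bounded_by B s \<Longrightarrow>
      (\<exists>t \<le> poly q2 B. exec (compile p2) s t (den p2 s)) \<and>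
      bounded_by (B + poly g2 (s ''n'' 0)) (den p2 s)" using Then by auto
  \<comment> \<open>The second part starts from cells of size at most \<open>B + poly g1 B\<close>,
    because \<open>n\<close> is itself a cell and thus at most \<open>B\<close>.\<close>
  show ?case
  proof (rule exI[of _ "q1 + pcompose q2 ([:0, 1:] + g1)"], rule exI[of _ "g1 + g2"],
      intro allI impI conjI)
    fix s B assume s: "bounded_by B s"
    let ?B' = "B + poly g1 (s ''n'' 0)"
    have s1: "bounded_by ?B' (den p1 s)" using 1[OF s] by simp
    have "?B' \<le> B + poly g1 B"
      using s poly_nat_mono[of "s ''n'' 0" B g1] by (simp add: bounded_by_def)
    then have B': "poly q2 ?B' \<le> poly q2 (B + poly g1 B)" by (rule poly_nat_mono)
    obtain t1 where t1: "t1 \<le> poly q1 B" "exec (compile p1) s t1 (den p1 s)"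
      using 1[OF s] by blast
    obtain t2 where t2: "t2 \<le> poly q2 ?B'" "exec (compile p2) (den p1 s) t2 (den p2 (den p1 s))"
      using 2[OF s1] by blast
    have "exec (compile (Then p1 p2)) s (t1 + t2) (den (Then p1 p2) s)"
      using exec.Seq t1(2) t2(2) by auto
    moreover have "t1 + t2 \<le> poly (q1 + pcompose q2 ([:0, 1:] + g1)) B"
      using t1(1) t2(1) B' by (simp add: poly_pcompose)
    ultimately show "\<exists>t \<le> poly (q1 + pcompose q2 ([:0, 1:] + g1)) B.
        exec (compile (Then p1 p2)) s t (den (Then p1 p2) s)" by blast
    have "den p1 s ''n'' 0 = s ''n'' 0" using Then.prems by (simp add: den_n)
    then show "bounded_by (B + poly (g1 + g2) (s ''n'' 0)) (den (Then p1 p2) s)"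
      using 2[OF s1] by (simp add: add.assoc)
  qed
next
  case (If b p1 p2)
  obtain q1 g1 where 1: "\<And>s B. bounded_by B s \<Longrightarrow>
      (\<exists>t \<le> poly q1 B. exec (compile p1) s t (den p1 s)) \<and>
      bounded_by (B + poly g1 (s ''n'' 0)) (den p1 s)" using If by auto
  obtain q2 g2 where 2: "\<And>s B. bounded_by B s \<Longrightarrow>
      (\<exists>t \<le> poly q2 B. exec (compile p2) s t (den p2 s)) \<and>
      bounded_by (B + poly g2 (s ''n'' 0)) (den p2 s)" using If by auto
  obtain r where r: "\<forall>s B. bounded_by B s \<longrightarrow> val b s \<le> poly r B \<and> val_time b s \<le> poly r B"
    using exp_poly_bound by blast
  show ?case
  proof (rule exI[of _ "[:1:] + r + q1 + q2"], rule exI[of _ "g1 + g2"],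
      intro allI impI conjI)
    fix s B assume s: "bounded_by B s"
    obtain t1 where t1: "t1 \<le> poly q1 B" "exec (compile p1) s t1 (den p1 s)"
      using 1[OF s] by blast
    obtain t2 where t2: "t2 \<le> poly q2 B" "exec (compile p2) s t2 (den p2 s)"
      using 2[OF s] by blast
    have rb: "val_time b s \<le> poly r B" using r s by blast
    show "\<exists>t \<le> poly ([:1:] + r + q1 + q2) B.
        exec (compile (If b p1 p2)) s t (den (If b p1 p2) s)"
    proof (cases "val b s = 0")
      case True
      with t2 have "exec (compile (If b p1 p2)) s (1 + val_time b s + t2) (den (If b p1 p2) s)"
        by (auto intro!: exec.CondFalse simp del: One_nat_def)
      moreover have "1 + val_time b s + t2 \<le> poly ([:1:] + r + q1 + q2) B" using t2 rb by simp
      ultimately show ?thesis by blast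
    next
      case False
      with t1 have "exec (compile (If b p1 p2)) s (1 + val_time b s + t1) (den (If b p1 p2) s)"
        by (auto intro!: exec.CondTrue simp del: One_nat_def)
      moreover have "1 + val_time b s + t1 \<le> poly ([:1:] + r + q1 + q2) B" using t1 rb by simp
      ultimately show ?thesis by blast
    qed
    show "bounded_by (B + poly (g1 + g2) (s ''n'' 0)) (den (If b p1 p2) s)"
      using 1[OF s] 2[OF s] by (auto elim!: bounded_by_mono)
  qed
next
  case (For x p)
  obtain q g where qg: "\<And>s B. bounded_by B s \<Longrightarrow>
      (\<exists>t \<le> poly q B. exec (compile p) s t (den p s)) \<and>
      bounded_by (B + poly g (s ''n'' 0)) (den p s)" using For by auto
  let ?b = "Less (var x) (var ''n'')" and ?e = "Plus (var x) (Lit 1)"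
  let ?inc = "Store x (Lit 0) ?e"
  obtain r1 where r1: "\<forall>s B. bounded_by B s \<longrightarrow> val ?b s \<le> poly r1 B \<and> val_time ?b s \<le> poly r1 B"
    using exp_poly_bound by blast
  obtain r2 where r2: "\<forall>s B. bounded_by B s \<longrightarrow> val ?e s \<le> poly r2 B \<and> val_time ?e s \<le> poly r2 B"
    using exp_poly_bound by blast
  define F where "F = (\<lambda>s. set_var x (Suc (den p s x 0)) (den p s))"
  define L where "L = charge 0"
  \<comment> \<open>\<open>D\<close> bounds all cells throughout the loop: each of at most
    \<open>B\<close> rounds adds \<open>poly g n\<close> through the body and \<open>1\<close>
    through the counter. \<open>C\<close> dominates the time of a round and that of a test.\<close>
  define D where "D = [:0, 1:] + [:0, 1:] * (g + [:1:])"
  define C where "C = pcompose (q + [:2 + L:] + r1 + r2) D"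
  show ?case
  proof (rule exI[of _ "[:1 + 2 * L:] + ([:0, 2:] + [:1:]) * C"],
      rule exI[of _ "[:0, 1:] * (g + [:1:])"], intro allI impI)
    fix s B assume s: "bounded_by B s"
    define n where "n = s ''n'' 0"
    define S where "S = (\<lambda>j. (F ^^ j) (set_var x 0 s))"
    have n: "n \<le> B" using s by (simp add: bounded_by_def n_def)
    have Sx: "S j x 0 = j" and Sn: "S j ''n'' 0 = n" for j
      using den_For_iterate[OF For.prems] by (auto simp: S_def F_def n_def)
    have SS: "S (Suc j) = set_var x (Suc (den p (S j) x 0)) (den p (S j))" for j
      by (simp add: S_def F_def)
    have bS: "bounded_by (B + j * (poly g n + 1)) (S j)" for j
    proof (induction j)
      case 0
      then show ?case using s by (simp add: S_def set_var_def bounded_by_def)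
    next
      case (Suc j)
      have "bounded_by (B + j * (poly g n + 1) + poly g n) (den p (S j))"
        using qg[OF Suc] by (simp add: Sn)
      then have le: "den p (S j) a i \<le> B + j * (poly g n + 1) + poly g n" for a i
        by (simp add: bounded_by_def)
      have "den p (S j) a i \<le> B + Suc j * (poly g n + 1)" for a i
        using le[of a i] by simp
      moreover have "Suc (den p (S j) x 0) \<le> B + Suc j * (poly g n + 1)"
        using le[of x 0] by simp
      ultimately show ?case by (simp add: SS set_var_def bounded_by_def)
    qed
    let ?M = "poly D B" 
    have M: "bounded_by ?M (S j)" if "j \<le> n" for j
    proof -
      have "j * (poly g n + 1) \<le> B * (poly g B + 1)"
        using that n poly_nat_mono[OF n, of g] by (intro mult_mono) auto
      then have "B + j * (poly g n + 1) \<le> ?M" by (simp add: D_def)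
      with bS[of j] show ?thesis by (rule bounded_by_mono)
    qed
    \<comment> \<open>The increment is charged in the state between the body and the counter update,
      so that state must be bounded too. As \<open>j < n\<close>, the growth of the body fits into
      the allowance for \<open>Suc j \<le> n\<close> rounds.\<close>
    have M': "bounded_by ?M (den p (S j))" if "j < n" for j
    proof -
      have "B + j * (poly g n + 1) + poly g n \<le> B + Suc j * (poly g n + 1)" by simp
      also have "Suc j * (poly g n + 1) \<le> B * (poly g B + 1)"
        using that n poly_nat_mono[OF n, of g] by (intro mult_mono) auto
      finally have "B + j * (poly g n + 1) + poly g n \<le> ?M" by (simp add: D_def)
      moreover have "bounded_by (B + j * (poly g n + 1) + poly g n) (den p (S j))"
        using qg[OF bS[of j]] by (simp add: Sn)
      ultimately show ?thesis using bounded_by_mono by blast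
    qed
    have step: "\<exists>t \<le> poly C B. exec (Seq (compile p) ?inc) (S j) t (S (Suc j))" if jn: "j < n" for j
    proof -
      obtain t where t: "t \<le> poly q ?M" "exec (compile p) (S j) t (den p (S j))"
        using qg[OF M[OF less_imp_le[OF jn]]] by blast
      have "exec ?inc (den p (S j)) (1 + val_time (Lit 0) (den p (S j)) + val_time ?e (den p (S j)))
          (S (Suc j))"
        using exec.Store[of x "Lit 0" ?e "den p (S j)"] by (simp add: SS set_var_def)
      with t(2) have "exec (Seq (compile p) ?inc) (S j)
          (t + (1 + val_time (Lit 0) (den p (S j)) + val_time ?e (den p (S j)))) (S (Suc j))"
        by (rule exec.Seq)
      moreover have "t + (1 + val_time (Lit 0) (den p (S j)) + val_time ?e (den p (S j)))
          \<le> poly C B"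
        using t(1) r2[rule_format, OF M'[OF jn]]
        by (simp add: C_def poly_pcompose L_def del: val_time.simps(2-))
      ultimately show ?thesis by blast
    qed
    have "\<exists>t \<le> (2 * n + 1) * poly C B.
        exec (While ?b (Seq (compile p) ?inc)) (S 0) t (S n)"
    proof (rule exec_While)
      show "val ?b (S j) \<noteq> 0 \<and>
          (\<exists>t \<le> poly C B. exec (Seq (compile p) ?inc) (S j) t (S (Suc j)))" if "j < n" for j
        using step[OF that] that by (simp add: Sx Sn)
      show "val ?b (S n) = 0" by (simp add: Sx Sn)
      show "1 + val_time ?b (S j) \<le> poly C B" if "j \<le> n" for j
        using r1[rule_format, OF M[OF that]]
        by (simp add: C_def poly_pcompose del: val_time.simps)
    qed
    then obtain t where t: "t \<le> (2 * n + 1) * poly C B"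
      "exec (While ?b (Seq (compile p) ?inc)) (S 0) t (S n)" by blast
    have "exec (Store x (Lit 0) (Lit 0)) s (1 + L + L) (S 0)"
      using exec.Store[of x "Lit 0" "Lit 0" s] by (simp add: L_def S_def set_var_def)
    from exec.Seq[OF this t(2)]
    have "exec (compile (For x p)) s (1 + L + L + t) (den (For x p) s)"
      by (simp add: S_def F_def n_def)
    moreover have "1 + L + L + t \<le> poly ([:1 + 2 * L:] + ([:0, 2:] + [:1:]) * C) B"
    proof -
      have "(2 * n + 1) * poly C B \<le> (2 * B + 1) * poly C B" using n by (intro mult_mono) auto
      with t(1) have "1 + L + L + t \<le> 1 + L + L + (2 * B + 1) * poly C B" by linarith
      then show ?thesis by (simp add: mult_ac)
    qed
    moreover have "bounded_by (B + poly ([:0, 1:] * (g + [:1:])) (s ''n'' 0)) (den (For x p) s)"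
      using bS[of n] by (simp add: S_def F_def n_def)
    ultimately show "(\<exists>t \<le> poly ([:1 + 2 * L:] + ([:0, 2:] + [:1:]) * C) B.
        exec (compile (For x p)) s t (den (For x p) s)) \<and>
        bounded_by (B + poly ([:0, 1:] * (g + [:1:])) (s ''n'' 0)) (den (For x p) s)"
      by blast
  qed
qed

text \<open>Invariant rule: the index of \<open>I\<close> counts completed rounds, and the counter
  \<open>x\<close> agrees with it at the start of every round.\<close>

lemma den_For_rule:
  assumes "wf_prog (For x p)"
    and "I 0 (set_var x 0 s)"
    and "\<And>i s'. i < s ''n'' 0 \<Longrightarrow> s' x 0 = i \<Longrightarrow> I i s' \<Longrightarrow> I (Suc i) (set_var x (Suc i) (den p s'))"
  shows "I (s ''n'' 0) (den (For x p) s)"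
proof -
  let ?F = "\<lambda>s. set_var x (Suc (den p s x 0)) (den p s)"
  have "I i ((?F ^^ i) (set_var x 0 s))" if "i \<le> s ''n'' 0" for i
    using that
  proof (induction i)
    case (Suc i)
    let ?s = "(?F ^^ i) (set_var x 0 s)"
    have x: "?s x 0 = i" using den_For_iterate(1)[OF assms(1)] .
    then have "den p ?s x 0 = i" using assms(1) by (simp add: den_unassigned)
    with assms(3)[of i ?s] Suc x show ?case by simp
  qed (use assms(2) in simp)
  then show ?thesis by simp
qed

section \<open>Path covers against the linear program\<close>

lemma finite_arcs: "finite V \<Longrightarrow> finite (arcs V)"
  by (rule finite_subset[of _ "V \<times> V"]) (auto simp: arcs_def)

text \<open>Grouping the arcs by head leaves one in-degree equation for each vertex of
  \<open>B\<close>.\<close>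

lemma SER_sum_into:
  assumes "finite V" "x \<in> SER V" "B \<subseteq> V"
  shows "sum x {e \<in> arcs V. snd e \<in> B} = card B"
proof -
  have "sum x {e \<in> arcs V. snd e \<in> B} = (\<Sum>v\<in>B. sum x {e \<in> {e \<in> arcs V. snd e \<in> B}. snd e = v})"
    using assms finite_arcs[of V] by (intro sum.group[symmetric]) (auto intro: finite_subset)
  also have "\<dots> = (\<Sum>v\<in>B. 1)"
  proof (rule sum.cong[OF refl])
    fix v assume "v \<in> B"
    then have "{e \<in> {e \<in> arcs V. snd e \<in> B}. snd e = v} = delta_in V {v}"
      by (auto simp: delta_in_def arcs_def)
    with \<open>v \<in> B\<close> assms show "sum x {e \<in> {e \<in> arcs V. snd e \<in> B}. snd e = v} = 1"
      by (auto simp: SER_def)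
  qed
  finally show ?thesis by simp
qed

lemma SER_sum_from:
  assumes "finite V" "x \<in> SER V" "A \<subseteq> V"
  shows "sum x {e \<in> arcs V. fst e \<in> A} = card A"
proof -
  have "sum x {e \<in> arcs V. fst e \<in> A} = (\<Sum>v\<in>A. sum x {e \<in> {e \<in> arcs V. fst e \<in> A}. fst e = v})"
    using assms finite_arcs[of V] by (intro sum.group[symmetric]) (auto intro: finite_subset)
  also have "\<dots> = (\<Sum>v\<in>A. 1)"
  proof (rule sum.cong[OF refl])
    fix v assume "v \<in> A"
    then have "{e \<in> {e \<in> arcs V. fst e \<in> A}. fst e = v} = delta_out V {v}"
      by (auto simp: delta_out_def arcs_def)
    with \<open>v \<in> A\<close> assms show "sum x {e \<in> {e \<in> arcs V. fst e \<in> A}. fst e = v} = 1"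
      by (auto simp: SER_def)
  qed
  finally show ?thesis by simp
qed

text \<open>An instance leaves \<open>c\<close> arbitrary on the diagonal, so loops are excluded
  explicitly; this makes \<open>cheap c\<close> irreflexive.\<close>

definition cheap :: "('v \<times> 'v \<Rightarrow> nat) \<Rightarrow> 'v \<Rightarrow> 'v \<Rightarrow> bool" where
  "cheap c u v \<longleftrightarrow> u \<noteq> v \<and> c (u, v) = 1"

text \<open>Weak duality: the dual solution has potential \<open>1\<close> at every head, raised by \<open>1\<close> on \<open>B\<close>, and
  \<open>-1\<close> at the tails in \<open>A\<close>.\<close>

lemma lp_cost_ge:
  assumes inst: "atsp12_instance V c" and x: "x \<in> SER V"
    and AB: "A \<subseteq> V" "B \<subseteq> V"
    and into: "\<And>u v. u \<in> V \<Longrightarrow> v \<in> B \<Longrightarrow> cheap c u v \<Longrightarrow> u \<in> A"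
  shows "real (card V) + real (card B) - real (card A) \<le> lp_cost V c x"
proof -
  have fin: "finite V" using inst by (simp add: atsp12_instance_def)
  have "real (card V) + real (card B) - real (card A) =
    sum x {e \<in> arcs V. snd e \<in> V} + sum x {e \<in> arcs V. snd e \<in> B} - sum x {e \<in> arcs V. fst e \<in> A}"
    using SER_sum_into[OF fin x] SER_sum_from[OF fin x] AB by simp
  also have "{e \<in> arcs V. snd e \<in> V} = arcs V" by (auto simp: arcs_def)
  also have "sum x {e \<in> arcs V. snd e \<in> B} = (\<Sum>e\<in>arcs V. if snd e \<in> B then x e else 0)"
    using finite_arcs[OF fin] by (rule sum.inter_filter)
  also have "sum x {e \<in> arcs V. fst e \<in> A} = (\<Sum>e\<in>arcs V. if fst e \<in> A then x e else 0)"
    using finite_arcs[OF fin] by (rule sum.inter_filter)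
  also have "sum x (arcs V) + (\<Sum>e\<in>arcs V. if snd e \<in> B then x e else 0)
      - (\<Sum>e\<in>arcs V. if fst e \<in> A then x e else 0)
    = (\<Sum>e\<in>arcs V. x e + (if snd e \<in> B then x e else 0) - (if fst e \<in> A then x e else 0))"
    by (simp add: sum.distrib sum_subtractf)
  also have "\<dots> \<le> (\<Sum>e\<in>arcs V. real (c e) * x e)"
  proof (rule sum_mono)
    fix e assume e: "e \<in> arcs V"
    obtain u v where uv: "e = (u, v)" by (cases e)
    have pos: "x e \<ge> 0" using x e by (simp add: SER_def)
    \<comment> \<open>The coefficient of \<open>x e\<close> on the left exceeds \<open>1\<close>
      only if the head is in \<open>B\<close> and the tail outside \<open>A\<close>; by
      \<open>into\<close> such an arc is not cheap and costs \<open>2\<close>.\<close>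
    have "c e = 1 \<or> c e = 2" using inst e by (auto simp: atsp12_instance_def)
    then show "x e + (if snd e \<in> B then x e else 0) - (if fst e \<in> A then x e else 0)
        \<le> real (c e) * x e"
      using pos e into[of u v] by (auto simp: uv arcs_def cheap_def)
  qed
  finally show ?thesis by (simp add: lp_cost_def)
qed

section \<open>Path covers built greedily\<close>

definition closable :: "('v \<Rightarrow> 'v \<Rightarrow> bool) \<Rightarrow> 'v list \<Rightarrow> bool" where
  "closable E P \<longleftrightarrow> E (last P) (hd P)"

text \<open>The path \<open>P\<close> cannot be extended by \<open>v\<close>; a closable path may first be rotated. Prepending
  to closable paths need not be excluded.\<close>

definition exhausted :: "('v \<Rightarrow> 'v \<Rightarrow> bool) \<Rightarrow> 'v list \<Rightarrow> 'v \<Rightarrow> bool" where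
  "exhausted E P v \<longleftrightarrow>
    (if closable E P then \<forall>u\<in>set P. \<not> E u v else \<not> E (last P) v \<and> \<not> E v (hd P))"

definition disjoint_paths :: "('v \<Rightarrow> 'v \<Rightarrow> bool) \<Rightarrow> 'v list list \<Rightarrow> bool" where
  "disjoint_paths E ps \<longleftrightarrow>
    distinct (concat ps) \<and> (\<forall>P \<in> set ps. P \<noteq> [] \<and> successively E P)"

text \<open>The list is in order of construction. A path is tested only against the vertices of
  later paths, since those of earlier ones are already taken when it gets stuck.\<close>

definition greedy_paths :: "('v \<Rightarrow> 'v \<Rightarrow> bool) \<Rightarrow> 'v list list \<Rightarrow> bool" where
  "greedy_paths E ps \<longleftrightarrow>
    disjoint_paths E ps \<and> sorted_wrt (\<lambda>P Q. \<forall>v \<in> set Q. exhausted E P v) ps"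

lemma distinct_map_hd:
  "distinct (concat ps) \<Longrightarrow> [] \<notin> set ps \<Longrightarrow> distinct (map hd ps)"
proof (induction ps)
  case (Cons P ps)
  have "hd P \<noteq> hd Q" if "Q \<in> set ps" for Q
  proof -
    have "hd P \<in> set P" "hd Q \<in> set Q" using Cons.prems that by (auto intro!: hd_in_set)
    with Cons.prems that show ?thesis by auto
  qed
  with Cons show ?case by auto
qed simp

lemma distinct_concat_filter: "distinct (concat ps) \<Longrightarrow> distinct (concat (filter R ps))"
  by (induction ps) auto

text \<open>Let \<open>u\<close> lie on \<open>C\<close>. If \<open>C\<close> precedes
  \<open>D\<close>, then \<open>hd D\<close> was available when \<open>C\<close> got stuck, so
  \<open>C\<close> does not close up and \<open>u\<close> is not its last vertex. If
  \<open>C = D\<close> and \<open>u\<close> were last, \<open>D\<close> would close up. If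
  \<open>C\<close> came after \<open>D\<close>, then \<open>u\<close> could have been prepended to
  \<open>D\<close>.\<close>

lemma greedy_paths_cheap_into_hd:
  assumes "greedy_paths E ps"
    and u: "u \<in> set (concat ps)" and D: "D \<in> set ps" "\<not> closable E D" and uv: "E u (hd D)"
  shows "\<exists>C \<in> set ps. \<not> closable E C \<and> u \<in> set (butlast C)"
proof -
  have nonempty: "P \<noteq> []" if "P \<in> set ps" for P
    using assms(1) that by (auto simp: greedy_paths_def disjoint_paths_def)
  have butlast: "u \<in> set (butlast C)" if "u \<in> set C" "u \<noteq> last C" for C :: "'a list"
    using that by (cases C rule: rev_cases) auto
  have ex: "exhausted E (ps ! i) v" if "i < j" "j < length ps" "v \<in> set (ps ! j)" for i j v
    using assms(1) that by (auto simp: greedy_paths_def sorted_wrt_iff_nth_less)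
  obtain j where j: "j < length ps" "ps ! j = D" using D by (auto simp: in_set_conv_nth)
  obtain i where i: "i < length ps" "u \<in> set (ps ! i)"
    using u by (metis UN_E in_set_conv_nth set_concat)
  let ?C = "ps ! i"
  have hdD: "hd D \<in> set D" using nonempty[OF D(1)] by simp
  consider "i < j" | "i = j" | "j < i" by linarith
  then have "\<not> closable E ?C \<and> u \<noteq> last ?C"
  proof cases
    case 1
    with ex[of i j "hd D"] j hdD have "exhausted E ?C (hd D)" by simp
    with uv i(2) show ?thesis by (auto simp: exhausted_def split: if_splits)
  next
    case 2
    with j D uv show ?thesis by (auto simp: closable_def)
  next
    case 3
    with ex[of j i u] i j have "exhausted E D u" by simp
    with uv D show ?thesis by (auto simp: exhausted_def)
  qed
  with butlast i show ?thesis by (intro bexI[of _ ?C]) auto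
qed

text \<open>This holds path by path. With \<open>l = length P\<close>, a path in \<open>N\<close>
  gives the equality \<open>2 * (l + 1) + (l - 1) = 3 * l + 1\<close>, and a closable one gives
  \<open>2 * (l + 1) \<le> 3 * l\<close>, because irreflexivity forces
  \<open>l \<ge> 2\<close>.\<close>

lemma weighted_path_count:
  assumes "\<forall>P \<in> set ps. P \<noteq> []" "\<And>v. \<not> E v v"
  defines "N \<equiv> filter (\<lambda>P. \<not> closable E P) ps"
  shows "2 * (\<Sum>P\<leftarrow>ps. length P + 1) + length (concat (map butlast N))
    \<le> 3 * length (concat ps) + length N"
  using assms(1) unfolding N_def
proof (induction ps)
  case (Cons P ps)
  have "2 \<le> length P" if "closable E P"
  proof (rule ccontr)
    assume "\<not> 2 \<le> length P"
    then obtain v where "P = [v]" using Cons.prems by (cases P) (auto simp: not_less_eq_eq)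
    with that assms(2) show False by (simp add: closable_def)
  qed
  moreover have "1 \<le> length P" using Cons.prems by (cases P) auto
  ultimately show ?case using Cons by auto
qed simp

section \<open>Costs of paths and tours\<close>

fun path_cost :: "('v \<times> 'v \<Rightarrow> nat) \<Rightarrow> 'v list \<Rightarrow> nat" where
  "path_cost c (u # v # vs) = c (u, v) + path_cost c (v # vs)"
| "path_cost c vs = 0"

lemma path_cost_append:
  "xs \<noteq> [] \<Longrightarrow> ys \<noteq> [] \<Longrightarrow>
    path_cost c (xs @ ys) = path_cost c xs + c (last xs, hd ys) + path_cost c ys"
  by (induction c xs rule: path_cost.induct) (auto simp: neq_Nil_conv)

lemma path_cost_snoc_eq: "(\<Sum>e\<leftarrow>zip (u # vs) (vs @ [v]). c e) = path_cost c (u # vs @ [v])"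
  by (induction vs arbitrary: u) auto

lemma tour_cost_eq:
  "vs \<noteq> [] \<Longrightarrow> tour_cost c vs = path_cost c vs + c (last vs, hd vs)"
  using path_cost_snoc_eq[of c "hd vs" "tl vs" "hd vs"] path_cost_append[of vs "[hd vs]" c]
  by (cases vs) (auto simp: tour_cost_def tour_arcs_def)

lemma path_cost_cheap: "successively (cheap c) P \<Longrightarrow> path_cost c P = length P - 1"
  by (induction c P rule: path_cost.induct) (auto simp: cheap_def)

text \<open>A path contributes \<open>length P - 1\<close> cheap arcs and each junction of
  consecutive paths at most \<open>2\<close>. The \<open>2\<close> left over pays for the arc that
  closes the tour.\<close>

lemma path_cost_concat_le:
  assumes "disjoint_paths (cheap c) ps" "ps \<noteq> []"
    and "\<And>u v. u \<in> set (concat ps) \<Longrightarrow> v \<in> set (concat ps) \<Longrightarrow> u \<noteq> v \<Longrightarrow> c (u, v) \<le> 2"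
  shows "path_cost c (concat ps) + 2 \<le> (\<Sum>P\<leftarrow>ps. length P + 1)"
  using assms
proof (induction ps)
  case (Cons P ps)
  have P: "P \<noteq> []" "path_cost c P + 1 = length P"
    using Cons.prems(1) path_cost_cheap[of c P] by (cases P; auto simp: disjoint_paths_def)+
  show ?case
  proof (cases "ps = []")
    case True
    with P show ?thesis by simp
  next
    case False
    then have ne: "concat ps \<noteq> []"
      using Cons.prems(1) by (cases ps) (auto simp: disjoint_paths_def)
    have IH: "path_cost c (concat ps) + 2 \<le> (\<Sum>P\<leftarrow>ps. length P + 1)"
      using Cons.prems False by (intro Cons.IH) (auto simp: disjoint_paths_def)
    have "last P \<in> set P" "hd (concat ps) \<in> set (concat ps)"
      using P ne by (auto intro: last_in_set hd_in_set simp del: set_concat)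
    moreover from this have "last P \<noteq> hd (concat ps)"
      using Cons.prems(1) by (force simp: disjoint_paths_def simp del: set_concat)
    ultimately have "c (last P, hd (concat ps)) \<le> 2" by (intro Cons.prems(3)) auto
    with IH P ne show ?thesis by (simp add: path_cost_append)
  qed
qed simp

theorem greedy_paths_tour_cost:
  assumes inst: "atsp12_instance V c"
    and ps: "greedy_paths (cheap c) ps" "set (concat ps) = V"
    and x: "x \<in> SER V"
  shows "real (tour_cost c (concat ps)) \<le> 3 / 2 * lp_cost V c x"
proof -
  let ?vs = "concat ps"
  define N where "N = filter (\<lambda>P. \<not> closable (cheap c) P) ps"
  define B where "B = set (map hd N)"
  define A where "A = set (concat (map butlast N))"
  have ps': "disjoint_paths (cheap c) ps" using ps(1) by (simp add: greedy_paths_def)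
  then have nonempty: "P \<noteq> []" if "P \<in> set ps" for P
    using that by (auto simp: disjoint_paths_def)
  have c2: "c (u, v) \<le> 2" if "u \<in> V" "v \<in> V" "u \<noteq> v" for u v
    using inst that by (fastforce simp: atsp12_instance_def arcs_def)
  have card_V: "card V = length ?vs"
    using ps' ps(2) distinct_card[of ?vs] by (simp add: disjoint_paths_def)
  have n2: "2 \<le> length ?vs" using inst card_V by (simp add: atsp12_instance_def)
  then have ne: "?vs \<noteq> []" by (cases ?vs) auto
  have "distinct (map hd N)"
    unfolding N_def using ps' by (intro distinct_map_hd distinct_concat_filter)
      (auto simp: disjoint_paths_def)
  then have card_B: "card B = length N"
    using distinct_card[of "map hd N"] by (simp add: B_def)
  have card_A: "card A \<le> length (concat (map butlast N))"
    unfolding A_def by (rule card_length)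
  have "A \<subseteq> V" using ps(2) by (auto simp: A_def N_def dest: in_set_butlastD)
  moreover have "B \<subseteq> V" using ps(2) nonempty by (fastforce simp: B_def N_def)
  moreover have "u \<in> A" if "u \<in> V" "v \<in> B" "cheap c u v" for u v
    using greedy_paths_cheap_into_hd[OF ps(1), of u] that ps(2)
    by (fastforce simp: A_def B_def N_def)
  ultimately have lp1: "real (card V) + real (card B) - real (card A) \<le> lp_cost V c x"
    by (rule lp_cost_ge[OF inst x])
  have lp2: "real (card V) \<le> lp_cost V c x"
    using lp_cost_ge[OF inst x, of "{}" "{}"] by simp
  \<comment> \<open>With at least two distinct vertices the closing pair is a genuine arc, so its
    cost is at most \<open>2\<close>.\<close>
  have "last ?vs \<noteq> hd ?vs"
  proof -
    have "?vs ! (length ?vs - 1) \<noteq> ?vs ! 0"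
      using ps' n2 by (subst nth_eq_iff_index_eq) (auto simp: disjoint_paths_def)
    then show ?thesis using ne by (simp add: last_conv_nth hd_conv_nth)
  qed
  then have "c (last ?vs, hd ?vs) \<le> 2"
    using last_in_set[OF ne] hd_in_set[OF ne] unfolding ps(2) by (intro c2)
  moreover have "path_cost c ?vs + 2 \<le> (\<Sum>P\<leftarrow>ps. length P + 1)"
    using ps' ne c2 ps(2) by (intro path_cost_concat_le) auto
  ultimately have "tour_cost c ?vs \<le> (\<Sum>P\<leftarrow>ps. length P + 1)"
    using tour_cost_eq[OF ne, of c] by simp
  moreover have "2 * (\<Sum>P\<leftarrow>ps. length P + 1) + length (concat (map butlast N))
      \<le> 3 * length ?vs + length N"
    unfolding N_def using nonempty by (intro weighted_path_count) (auto simp: cheap_def)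
  ultimately have "2 * tour_cost c ?vs + card A \<le> 3 * card V + card B"
    using card_A card_B card_V by linarith
  then have "2 * real (tour_cost c ?vs) + real (card A) \<le> 3 * real (card V) + real (card B)"
    by (metis (mono_tags, opaque_lifting) of_nat_add of_nat_le_iff of_nat_mult of_nat_numeral)
  \<comment> \<open>\<open>lp1\<close> plus twice \<open>lp2\<close> bounds
    \<open>3 |V| + |B| - |A|\<close> by three times the LP cost.\<close>
  with lp1 lp2 show ?thesis by linarith
qed

section \<open>Passing to the strengthened relaxation\<close>

definition cyc_succ :: "nat \<Rightarrow> nat \<Rightarrow> nat" where
  "cyc_succ n i = (if Suc i = n then 0 else Suc i)"

text \<open>From any element, successors lead up to \<open>n - 1\<close>, wrap around to
  \<open>0\<close> and then reach everything. For a nonempty proper subset this means that the cycle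
  leaves it.\<close>

lemma cyc_succ_closed:
  assumes S: "S \<subseteq> {..<n}" "S \<noteq> {}" and cl: "\<And>i. i \<in> S \<Longrightarrow> cyc_succ n i \<in> S"
  shows "S = {..<n}"
proof -
  obtain i where i: "i \<in> S" "i < n" using S by auto
  have up: "i + d \<in> S" if "i \<in> S" "i + d < n" for i d
    using that
  proof (induction d)
    case (Suc d)
    then show ?case using cl[of "i + d"] by (simp add: cyc_succ_def)
  qed simp
  have "n - 1 \<in> S" using up[of i "n - 1 - i"] i by simp
  then have "0 \<in> S" using cl[of "n - 1"] i by (simp add: cyc_succ_def)
  then have "j \<in> S" if "j < n" for j using up[of 0 j] that by simp
  with S show ?thesis by auto
qed

text \<open>The indicator vector of the tour \<open>0, 1, ..., n - 1\<close>.\<close>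

definition cyc_point :: "nat \<Rightarrow> nat \<times> nat \<Rightarrow> real" where
  "cyc_point n e = (if fst e < n \<and> snd e = cyc_succ n (fst e) then 1 else 0)"

lemma cyc_succ_less: "i < n \<Longrightarrow> cyc_succ n i < n"
  by (simp add: cyc_succ_def)

lemma cyc_succ_neq: "2 \<le> n \<Longrightarrow> cyc_succ n i \<noteq> i"
  by (auto simp: cyc_succ_def)

lemma cyc_point_SER:
  assumes n: "2 \<le> n"
  shows "cyc_point n \<in> SER {..<n}"
proof -
  let ?V = "{..<n}" and ?x = "cyc_point n"
  have fin: "finite (delta_in ?V S)" "finite (delta_out ?V S)" for S
    by (rule finite_subset[OF _ finite_arcs[of ?V]]; auto simp: delta_in_def delta_out_def)+
  have pos: "0 \<le> ?x e" for e by (simp add: cyc_point_def)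
  have cut: "\<exists>i \<in> S. cyc_succ n i \<in> ?V - S" if S: "S \<noteq> {}" "S \<subset> ?V" for S
    using S cyc_succ_closed[of S n] cyc_succ_less[of _ n] by blast
  have one: "1 \<le> sum ?x F" if "finite F" "i < n" "(i, cyc_succ n i) \<in> F" for F i
    using member_le_sum[of "(i, cyc_succ n i)" F ?x] that pos by (simp add: cyc_point_def)
  have single: "sum ?x F = 1"
    if "finite F" "(i, cyc_succ n i) \<in> F" "i < n"
      and uniq: "\<And>u. (u, cyc_succ n u) \<in> F \<Longrightarrow> u < n \<Longrightarrow> u = i" for F i
  proof -
    have "?x e = (if e = (i, cyc_succ n i) then 1 else 0)" if "e \<in> F" for e
    proof (cases "fst e < n \<and> snd e = cyc_succ n (fst e)")
      case True
      with \<open>e \<in> F\<close> have "fst e = i" by (intro uniq) (metis prod.collapse, simp)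
      with True show ?thesis by (simp add: cyc_point_def prod_eq_iff)
    next
      case False
      with \<open>i < n\<close> show ?thesis by (auto simp: cyc_point_def)
    qed
    then have "sum ?x F = (\<Sum>e\<in>F. if e = (i, cyc_succ n i) then 1 else 0)"
      by (intro sum.cong) auto
    then show ?thesis using that(1,2) by simp
  qed
  have arc: "(i, cyc_succ n i) \<in> arcs ?V" if "i < n" for i
    using that cyc_succ_less[of i n] cyc_succ_neq[OF n, of i] unfolding arcs_def by simp
  show ?thesis
    unfolding SER_def
  proof (intro CollectI conjI allI impI ballI)
    show "?x e = 0" if "e \<notin> arcs ?V" for e
      using that arc by (cases e) (auto simp: cyc_point_def)
    show "0 \<le> ?x e" for e by (rule pos)
  next
    fix v assume v: "v \<in> ?V"
    \<comment> \<open>\<open>u\<close> is the cyclic predecessor of \<open>v\<close>, the tail of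
      the only arc of the cycle entering \<open>v\<close>.\<close>
    define u where "u = (if v = 0 then n - 1 else v - 1)"
    have u: "u < n" "cyc_succ n u = v" using v n by (auto simp: u_def cyc_succ_def)
    have inj: "i = u" if "i < n" "cyc_succ n i = v" for i
      using that u by (auto simp: cyc_succ_def split: if_splits)
    show "sum ?x (delta_in ?V {v}) = 1"
      using u arc[of u] cyc_succ_neq[OF n, of u]
      by (intro single[OF fin(1), of u]) (auto simp: delta_in_def intro: inj)
    show "sum ?x (delta_out ?V {v}) = 1"
      using v arc[of v] cyc_succ_neq[OF n, of v]
      by (intro single[OF fin(2), of v]) (auto simp: delta_out_def)
  next
    fix S assume S: "S \<noteq> {} \<and> S \<subset> ?V"
    then obtain i where "i \<in> S" "cyc_succ n i \<in> ?V - S" using cut by blast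
    with S arc[of i] show "1 \<le> sum ?x (delta_out ?V S)"
      by (intro one[OF fin(2), of i]) (auto simp: delta_out_def)
    \<comment> \<open>The cycle enters \<open>S\<close> where it leaves the complement.\<close>
    from S have "?V - S \<noteq> {}" "?V - S \<subset> ?V" by auto
    from cut[OF this] obtain i where "i \<in> ?V - S" "cyc_succ n i \<in> ?V - (?V - S)" by blast
    with S arc[of i] show "1 \<le> sum ?x (delta_in ?V S)"
      by (intro one[OF fin(1), of i]) (auto simp: delta_in_def)
  qed
qed

text \<open>Integrality is the point: an integer that is at least \<open>Opt_SER\<close> is at least
  its ceiling.\<close>

lemma cyc_point_lp_cost: "\<exists>k. lp_cost V c (cyc_point n) = real k"
proof -
  have "lp_cost V c (cyc_point n) =
      real (\<Sum>e\<in>arcs V. if fst e < n \<and> snd e = cyc_succ n (fst e) then c e else 0)"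
    unfolding lp_cost_def of_nat_sum by (intro sum.cong) (auto simp: cyc_point_def)
  then show ?thesis by blast
qed

lemma lp_cost_nonneg: "x \<in> SER V \<Longrightarrow> 0 \<le> lp_cost V c x"
  unfolding lp_cost_def by (intro sum_nonneg mult_nonneg_nonneg) (auto simp: SER_def)

text \<open>An integral point of \<open>SER\<close> survives the rounding constraint; without one the infimum
  over the strengthened polytope would be a junk value.\<close>

lemma SER_plus_nonempty:
  fixes n :: nat
  assumes "2 \<le> n"
  shows "SER_plus {..<n} c \<noteq> {}"
proof -
  obtain k where k: "lp_cost {..<n} c (cyc_point n) = real k" using cyc_point_lp_cost by blast
  have "Opt_SER {..<n} c \<le> lp_cost {..<n} c (cyc_point n)"
    unfolding Opt_SER_def
    by (intro cINF_lower bdd_belowI2[of _ 0] lp_cost_nonneg cyc_point_SER assms)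
  then have "\<lceil>Opt_SER {..<n} c\<rceil> \<le> int k" by (simp add: k ceiling_le_iff)
  then have "cyc_point n \<in> SER_plus {..<n} c"
    using cyc_point_SER[OF assms] k by (simp add: SER_plus_def)
  then show ?thesis by blast
qed

text \<open>The rounding constraint only shrinks the polytope, so the bound valid at every point of
  \<open>SER\<close> carries over to the infimum over \<open>SER_plus\<close>.\<close>

lemma greedy_paths_tour_cost_Opt:
  fixes n :: nat
  assumes inst: "atsp12_instance {..<n} c"
    and ps: "greedy_paths (cheap c) ps" "set (concat ps) = {..<n}"
  shows "real (tour_cost c (concat ps)) \<le> 3 / 2 * Opt_SER_plus {..<n} c"
proof -
  have "SER_plus {..<n} c \<noteq> {}"
    using inst by (intro SER_plus_nonempty) (simp add: atsp12_instance_def)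
  moreover have "2 / 3 * real (tour_cost c (concat ps)) \<le> lp_cost {..<n} c x"
    if "x \<in> SER_plus {..<n} c" for x
    using greedy_paths_tour_cost[OF inst ps, of x] that by (simp add: SER_plus_def)
  ultimately have "2 / 3 * real (tour_cost c (concat ps)) \<le> Opt_SER_plus {..<n} c"
    unfolding Opt_SER_plus_def by (intro cINF_greatest)
  then show ?thesis by simp
qed

section \<open>The greedy algorithm\<close>

text \<open>Memory layout: from round \<open>1\<close> on, \<open>m\<close> counts the vertices
  placed before the round, and \<open>s\<close> is the index where the current path starts. Cells of
  \<open>tour\<close> below \<open>s\<close> hold the completed paths, those from \<open>s\<close>
  to \<open>m - 1\<close> the current one. \<open>done\<close> is set once the round has placed its
  vertex.\<close>

abbreviation last_vertex :: exp where
  "last_vertex \<equiv> Cell ''tour'' (Minus (var ''m'') (Lit 1))"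

abbreviation first_vertex :: exp where
  "first_vertex \<equiv> Cell ''tour'' (var ''s'')"

definition cheap_test :: "exp \<Rightarrow> exp \<Rightarrow> exp" where
  "cheap_test e f = Eq (Cell ''cost'' (Plus (Times e (var ''n'')) f)) (Lit 1)"

definition pending :: exp where
  "pending = Eq (var ''done'') (Lit 0)"

definition append_vertex :: prog where
  "append_vertex = Then (Assign ''tour'' (var ''m'') (var ''v''))
     (Then (Assign ''used'' (var ''v'') (Lit 1)) (Assign ''done'' (Lit 0) (Lit 1)))"

definition new_path :: prog where
  "new_path = Then (Assign ''s'' (Lit 0) (var ''m'')) append_vertex"

text \<open>Inserts \<open>x\<close> in front of the segment of \<open>tour\<close> from \<open>s\<close> on; the element at \<open>m + k - 1\<close> is
  pushed out.\<close>

definition shift :: "nat \<Rightarrow> prog" where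
  "shift k = For ''p''
     (If (Times (Less (var ''p'') (Plus (var ''m'') (Lit k))) (Less (var ''s'') (Plus (var ''p'') (Lit 1))))
       (Then (Assign ''y'' (Lit 0) (Cell ''tour'' (var ''p'')))
         (Then (Assign ''tour'' (var ''p'') (var ''x'')) (Assign ''x'' (Lit 0) (var ''y''))))
       Nop)"

text \<open>With \<open>k = 0\<close> the element pushed out is the last vertex, which reappears in
  front. With \<open>k = 1\<close>, as in \<open>prepend_vertex\<close>, it is the content of the
  free cell \<open>m\<close>.\<close>

definition rotate_path :: prog where
  "rotate_path = Then (Assign ''x'' (Lit 0) last_vertex) (shift 0)"

definition prepend_vertex :: prog where
  "prepend_vertex = Then (Assign ''x'' (Lit 0) (var ''v'')) (Then (shift 1)
     (Then (Assign ''used'' (var ''v'') (Lit 1)) (Assign ''done'' (Lit 0) (Lit 1))))"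

text \<open>The loop always runs through all vertices; \<open>pending\<close> acts as an early exit
  by disabling the body after the first success.\<close>

definition try_vertices :: "exp \<Rightarrow> prog \<Rightarrow> prog" where
  "try_vertices b p = For ''v''
     (If (Times pending (Times (Eq (Cell ''used'' (var ''v'')) (Lit 0)) b)) p Nop)"

definition try_rotations :: prog where
  "try_rotations = For ''r'' (Then (try_vertices (cheap_test last_vertex (var ''v'')) append_vertex)
     (If (Times pending (cheap_test last_vertex first_vertex)) rotate_path Nop))"

definition add_vertex :: prog where
  "add_vertex = Then try_rotations
     (Then (try_vertices (cheap_test (var ''v'') first_vertex) prepend_vertex)
       (try_vertices (Lit 1) new_path))"

text \<open>Vertex \<open>0\<close> is on the tour from the start, so the round \<open>m = 0\<close> has nothing to do.\<close>

definition greedy :: prog where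
  "greedy = Then (Assign ''used'' (Lit 0) (Lit 1))
     (For ''m'' (Then (Assign ''done'' (Lit 0) (Eq (var ''m'') (Lit 0))) add_vertex))"

lemmas prog_defs = cheap_test_def pending_def append_vertex_def new_path_def shift_def
  rotate_path_def prepend_vertex_def try_vertices_def try_rotations_def add_vertex_def greedy_def

lemma wf_greedy: "wf_prog greedy"
  by (simp add: prog_defs)

lemma den_shift:
  fixes s :: state and k :: nat
  defines "s' \<equiv> den (shift k) s"
  assumes "s ''s'' 0 < s ''m'' 0 + k" "s ''m'' 0 + k \<le> s ''n'' 0"
  shows "a \<notin> {''p'', ''x'', ''y'', ''tour''} \<Longrightarrow> s' a = s a"
    and "s' ''tour'' i = (if s ''s'' 0 \<le> i \<and> i < s ''m'' 0 + k
      then if i = s ''s'' 0 then s ''x'' 0 else s ''tour'' (i - 1) else s ''tour'' i)"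
proof -
  show "a \<notin> {''p'', ''x'', ''y'', ''tour''} \<Longrightarrow> s' a = s a"
    unfolding s'_def by (rule den_unassigned) (simp add: shift_def)
  define lo h where "lo = s ''s'' 0" and "h = s ''m'' 0 + k"
  define T where "T = (\<lambda>i. if i = lo then s ''x'' 0 else s ''tour'' (i - 1))"
  \<comment> \<open>Before round \<open>i\<close>, the segment cells below \<open>i\<close> have
    their final content and \<open>x\<close> carries the element to be written next. Beyond
    \<open>h\<close> the body is idle and nothing is claimed of \<open>x\<close>.\<close>
  define I where "I = (\<lambda>i s'. s' ''s'' 0 = lo \<and> s' ''m'' 0 + k = h \<and>
      (\<forall>j. s' ''tour'' j = (if lo \<le> j \<and> j < h \<and> j < i then T j else s ''tour'' j)) \<and>
      (i \<le> h \<longrightarrow> s' ''x'' 0 = (if i \<le> lo then s ''x'' 0 else s ''tour'' (i - 1))))"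
  have "I (s ''n'' 0) s'"
    unfolding s'_def shift_def
  proof (rule den_For_rule)
    show "I 0 (set_var ''p'' 0 s)" by (simp add: I_def set_var_def lo_def h_def)
  next
    fix i s'
    assume "s' ''p'' 0 = i" "I i s'"
    then show "I (Suc i) (set_var ''p'' (Suc i) (den (If
        (Times (Less (var ''p'') (Plus (var ''m'') (Lit k)))
          (Less (var ''s'') (Plus (var ''p'') (Lit 1))))
        (Then (Assign ''y'' (Lit 0) (Cell ''tour'' (var ''p'')))
         (Then (Assign ''tour'' (var ''p'') (var ''x'')) (Assign ''x'' (Lit 0) (var ''y''))))
       Nop) s'))"
      by (auto simp: I_def set_var_def T_def less_Suc_eq)
  qed simp
  with assms show "s' ''tour'' i = (if s ''s'' 0 \<le> i \<and> i < s ''m'' 0 + k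
      then if i = s ''s'' 0 then s ''x'' 0 else s ''tour'' (i - 1) else s ''tour'' i)"
    by (auto simp: I_def T_def lo_def h_def)
qed

section \<open>Correctness of the greedy program: partial covers\<close>

context
  fixes n :: nat and c :: "nat \<times> nat \<Rightarrow> nat"
begin

text \<open>\<open>ps\<close> are the completed paths, \<open>Q\<close> is the current one.
  Exhaustion is demanded for all vertices outside \<open>ps\<close>, including those not yet placed,
  so that \<open>Q\<close> may be replaced by any path avoiding \<open>ps\<close>.\<close>

definition partial_cover :: "nat list list \<Rightarrow> nat list \<Rightarrow> bool" where
  "partial_cover ps Q \<longleftrightarrow> greedy_paths (cheap c) (ps @ [Q]) \<and> set (concat (ps @ [Q])) \<subseteq> {..<n} \<and>
     (\<forall>P \<in> set ps. \<forall>v<n. v \<notin> set (concat ps) \<longrightarrow> exhausted (cheap c) P v)"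

lemma partial_cover_change:
  assumes "partial_cover ps Q"
    and "Q' \<noteq> []" "successively (cheap c) Q'" "distinct Q'"
    and "set Q' \<inter> set (concat ps) = {}" "set Q' \<subseteq> {..<n}"
  shows "partial_cover ps Q'"
proof -
  have "exhausted (cheap c) P v" if "P \<in> set ps" "v \<in> set Q'" for P v
  proof -
    have "v < n" "v \<notin> set (concat ps)" using assms that by blast+
    with assms(1) that show ?thesis unfolding partial_cover_def by blast
  qed
  with assms show ?thesis
    unfolding partial_cover_def greedy_paths_def disjoint_paths_def
    by (simp add: sorted_wrt_append Int_commute)
qed

lemma partial_coverD:
  assumes "partial_cover ps Q"
  shows "Q \<noteq> []" "successively (cheap c) Q" "distinct Q" "set Q \<inter> set (concat ps) = {}"
    "set Q \<subseteq> {..<n}" "distinct (concat ps @ Q)" "set (concat ps) \<subseteq> {..<n}"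
  using assms by (auto simp: partial_cover_def greedy_paths_def disjoint_paths_def)

lemma partial_cover_append:
  assumes "partial_cover ps Q" "v < n" "v \<notin> set (concat ps @ Q)" "cheap c (last Q) v"
  shows "partial_cover ps (Q @ [v])"
  using assms(2-) partial_coverD[OF assms(1)]
  by (intro partial_cover_change[OF assms(1)]) (auto simp: successively_append_iff)

lemma partial_cover_prepend:
  assumes "partial_cover ps Q" "v < n" "v \<notin> set (concat ps @ Q)" "cheap c v (hd Q)"
  shows "partial_cover ps (v # Q)"
  using assms(2-) partial_coverD[OF assms(1)]
  by (intro partial_cover_change[OF assms(1)]) (auto simp: successively_Cons)

text \<open>A closable path has at least two vertices, so \<open>Q = R @ [u, v]\<close>. Rotation
  moves the old closing arc, which leaves \<open>v\<close>, into the path, and the arc from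
  \<open>u\<close> to \<open>v\<close> becomes the new closing arc.\<close>

lemma closable_rotate:
  assumes "Q \<noteq> []" "successively (cheap c) Q" "closable (cheap c) Q"
  shows "successively (cheap c) (last Q # butlast Q)" "closable (cheap c) (last Q # butlast Q)"
proof -
  have "butlast Q \<noteq> []"
    using assms(1,3) by (cases Q) (auto simp: closable_def cheap_def split: if_splits)
  then obtain R u where "butlast Q = R @ [u]" by (cases "butlast Q" rule: rev_cases) auto
  with assms(1) obtain v where Q: "Q = R @ [u, v]"
    by (metis append.assoc append_Cons append_Nil append_butlast_last_id)
  then show "successively (cheap c) (last Q # butlast Q)"
    "closable (cheap c) (last Q # butlast Q)"
    using assms
    by (auto simp: closable_def successively_append_iff successively_Cons hd_append butlast_append
        split: if_splits)
qed

lemma set_rotate_path: "Q \<noteq> [] \<Longrightarrow> set (last Q # butlast Q) = set Q"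
  by (cases Q rule: rev_cases) auto

lemma partial_cover_rotate:
  assumes "partial_cover ps Q" "closable (cheap c) Q"
  shows "partial_cover ps (last Q # butlast Q)"
proof -
  note D = partial_coverD[OF assms(1)]
  have "distinct (last Q # butlast Q)"
    using D(1,3) by (cases Q rule: rev_cases) auto
  with D closable_rotate[OF D(1,2) assms(2)] set_rotate_path[OF D(1)] show ?thesis
    by (intro partial_cover_change[OF assms(1)]) (simp_all del: set_simps)
qed

lemma partial_cover_new:
  assumes "partial_cover ps Q" "v < n" "v \<notin> set (concat ps @ Q)"
    and "\<And>v. v < n \<Longrightarrow> v \<notin> set (concat ps @ Q) \<Longrightarrow> exhausted (cheap c) Q v"
  shows "partial_cover (ps @ [Q]) [v]"
  using assms unfolding partial_cover_def greedy_paths_def disjoint_paths_def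
  by (auto simp: sorted_wrt_append)

text \<open>Loop counters, scratch variables, \<open>m\<close> and \<open>done\<close> are left out,
  so the relation survives updates of them.\<close>

definition represents :: "nat list list \<Rightarrow> nat list \<Rightarrow> state \<Rightarrow> bool" where
  "represents ps Q s \<longleftrightarrow> partial_cover ps Q \<and> s ''n'' 0 = n \<and>
    (\<forall>u<n. \<forall>v<n. s ''cost'' (u * n + v) = 1 \<longleftrightarrow> cheap c u v) \<and>
    s ''s'' 0 = length (concat ps) \<and>
    (\<forall>i<length (concat ps). s ''tour'' i = concat ps ! i) \<and>
    (\<forall>i<length Q. s ''tour'' (length (concat ps) + i) = Q ! i) \<and>
    (\<forall>v<n. s ''used'' v = 0 \<longleftrightarrow> v \<notin> set (concat ps @ Q))"

lemma represents_tour: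
  assumes "represents ps Q s" "i < length (concat ps @ Q)"
  shows "s ''tour'' i = (concat ps @ Q) ! i"
proof (cases "i < length (concat ps)")
  case True
  with assms(1) have "s ''tour'' i = concat ps ! i" unfolding represents_def by blast
  with True show ?thesis by (simp only: nth_append if_True)
next
  case False
  define j where "j = i - length (concat ps)"
  have i: "i = length (concat ps) + j" using False by (simp add: j_def)
  with assms(2) have "j < length Q" by simp
  with assms(1) have "s ''tour'' i = Q ! j" unfolding represents_def i by blast
  then show ?thesis unfolding i by (simp only: nth_append_length_plus)
qed

definition unfinished :: "nat \<Rightarrow> nat list list \<Rightarrow> nat list \<Rightarrow> state \<Rightarrow> bool" where
  "unfinished m ps Q s \<longleftrightarrow> represents ps Q s \<and> length (concat ps @ Q) = m \<and> m < n \<and>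
    s ''m'' 0 = m \<and> s ''done'' 0 = 0"

text \<open>The outer counter still reads \<open>m\<close> after round \<open>m\<close> has placed
  its vertex, whence \<open>Suc m\<close> vertices. The cover is hidden because the rest of the
  round merely preserves it.\<close>

definition finished :: "nat \<Rightarrow> state \<Rightarrow> bool" where
  "finished m s \<longleftrightarrow> (\<exists>ps Q. represents ps Q s \<and> length (concat ps @ Q) = Suc m) \<and>
    s ''n'' 0 = n \<and> s ''m'' 0 = m \<and> s ''done'' 0 \<noteq> 0"

lemma represents_cong:
  "(\<And>a. a \<in> {''n'', ''cost'', ''s'', ''tour'', ''used''} \<Longrightarrow> s' a = s a) \<Longrightarrow>
    represents ps Q s' = represents ps Q s"
  by (simp add: represents_def)

lemma represents_set_var:
  "x \<notin> {''n'', ''cost'', ''s'', ''tour'', ''used''} \<Longrightarrow>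
    represents ps Q (set_var x k s) = represents ps Q s"
  by (rule represents_cong) (auto simp: set_var_def)

lemma unfinished_set_var:
  "x \<notin> {''n'', ''cost'', ''s'', ''tour'', ''used'', ''m'', ''done''} \<Longrightarrow>
    unfinished m ps Q (set_var x k s) = unfinished m ps Q s"
  by (simp add: unfinished_def represents_set_var) (auto simp: set_var_def)

lemma finished_set_var:
  "x \<notin> {''n'', ''cost'', ''s'', ''tour'', ''used'', ''m'', ''done''} \<Longrightarrow>
    finished m (set_var x k s) = finished m s"
  by (simp add: finished_def represents_set_var) (auto simp: set_var_def)

lemma unfinishedD:
  assumes "unfinished m ps Q s"
  shows "partial_cover ps Q" "s ''n'' 0 = n" "s ''m'' 0 = m" "s ''done'' 0 = 0" "m < n"
    "length (concat ps) + length Q = m" "Q \<noteq> []" "set Q \<subseteq> {..<n}"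
    "s ''tour'' (m - 1) = last Q" "s ''tour'' (s ''s'' 0) = hd Q" "last Q < n" "hd Q < n"
    "\<And>u v. u < n \<Longrightarrow> v < n \<Longrightarrow> s ''cost'' (u * n + v) = 1 \<longleftrightarrow> cheap c u v"
    "\<And>v. v < n \<Longrightarrow> s ''used'' v = 0 \<longleftrightarrow> v \<notin> set (concat ps @ Q)"
proof -
  show Q: "partial_cover ps Q" "s ''n'' 0 = n" "s ''m'' 0 = m" "s ''done'' 0 = 0" "m < n"
    "length (concat ps) + length Q = m"
    "\<And>u v. u < n \<Longrightarrow> v < n \<Longrightarrow> s ''cost'' (u * n + v) = 1 \<longleftrightarrow> cheap c u v"
    "\<And>v. v < n \<Longrightarrow> s ''used'' v = 0 \<longleftrightarrow> v \<notin> set (concat ps @ Q)"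
    using assms by (simp_all add: unfinished_def represents_def)
  show ne: "Q \<noteq> []" "set Q \<subseteq> {..<n}" using partial_coverD[OF Q(1)] by auto
  show "last Q < n" "hd Q < n" using last_in_set[OF ne(1)] hd_in_set[OF ne(1)] ne(2) by auto
  have tour: "s ''tour'' (length (concat ps) + i) = Q ! i" if "i < length Q" for i
    using assms that by (simp add: unfinished_def represents_def)
  show "s ''tour'' (m - 1) = last Q"
    using tour[of "length Q - 1"] ne Q(6) by (cases Q rule: rev_cases) auto
  show "s ''tour'' (s ''s'' 0) = hd Q"
    using tour[of 0] ne assms by (simp add: unfinished_def represents_def hd_conv_nth)
qed

lemma val_cheap_test:
  assumes "s ''n'' 0 = n" "val e s = u" "val f s = v"
    and "\<And>u v. u < n \<Longrightarrow> v < n \<Longrightarrow> s ''cost'' (u * n + v) = 1 \<longleftrightarrow> cheap c u v"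
    and "u < n" "v < n"
  shows "val (cheap_test e f) s \<noteq> 0 \<longleftrightarrow> cheap c u v"
  using assms by (simp add: cheap_test_def)

section \<open>Effects of single moves on the machine state\<close>

lemma finished_append_vertex:
  assumes s: "unfinished m ps Q s" and v: "s ''v'' 0 = v" "v < n" "v \<notin> set (concat ps @ Q)"
    and cheap: "cheap c (last Q) v"
  shows "finished m (den append_vertex s)"
proof -
  note D = unfinishedD[OF s]
  have "represents ps (Q @ [v]) (den append_vertex s)"
    using s v partial_cover_append[OF D(1) v(2,3) cheap]
    by (auto simp: append_vertex_def represents_def unfinished_def nth_append)
  then show ?thesis
    using D by (auto simp: finished_def append_vertex_def intro!: exI[of _ ps] exI[of _ "Q @ [v]"])
qed

lemma finished_new_path:
  assumes s: "unfinished m ps Q s" and v: "s ''v'' 0 = v" "v < n" "v \<notin> set (concat ps @ Q)"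
    and ex: "\<And>v. v < n \<Longrightarrow> v \<notin> set (concat ps @ Q) \<Longrightarrow> exhausted (cheap c) Q v"
  shows "finished m (den new_path s)"
proof -
  note D = unfinishedD[OF s]
  have rep: "represents ps Q s" using s by (simp add: unfinished_def)
  have tour: "s ''tour'' i = (concat ps @ Q) ! i" if "i < m" for i
    using that D(6) by (intro represents_tour[OF rep]) simp
  have "represents (ps @ [Q]) [v] (den new_path s)"
    using s v tour D(6) partial_cover_new[OF D(1) v(2,3) ex]
    by (auto simp: new_path_def append_vertex_def represents_def unfinished_def)
  then show ?thesis
    using D by (auto simp: finished_def new_path_def append_vertex_def
        intro!: exI[of _ "ps @ [Q]"] exI[of _ "[v]"])
qed

lemma finished_prepend_vertex:
  assumes s: "unfinished m ps Q s" and v: "s ''v'' 0 = v" "v < n" "v \<notin> set (concat ps @ Q)"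
    and cheap: "cheap c v (hd Q)"
  shows "finished m (den prepend_vertex s)"
proof -
  note D = unfinishedD[OF s]
  define s1 where "s1 = den (Assign ''x'' (Lit 0) (var ''v'')) s"
  define s2 where "s2 = den (shift 1) s1"
  have s': "den prepend_vertex s = s2(''used'' := (s2 ''used'')(v := 1),
      ''done'' := (s2 ''done'')(0 := 1))"
    using v den_unassigned[of "''v''" "shift 1" s1]
    by (simp add: prepend_vertex_def s2_def s1_def shift_def)
  have len: "s1 ''s'' 0 < s1 ''m'' 0 + 1" "s1 ''m'' 0 + 1 \<le> s1 ''n'' 0"
    using s by (auto simp: s1_def unfinished_def represents_def)
  have frame: "s2 a = s a" if "a \<notin> {''p'', ''x'', ''y'', ''tour''}" for a
    using den_shift(1)[where k = 1 and s = s1, OF len that] that by (simp add: s2_def s1_def)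
  have tour: "s2 ''tour'' i = (if s ''s'' 0 \<le> i \<and> i < Suc m
      then if i = s ''s'' 0 then v else s ''tour'' (i - 1) else s ''tour'' i)" for i
    using den_shift(2)[where k = 1 and s = s1, OF len, of i] D(3) v by (simp add: s2_def s1_def)
  have seg: "s2 ''tour'' (length (concat ps) + i) = (v # Q) ! i" if "i < Suc (length Q)" for i
    using that s D(6) by (cases i) (auto simp: tour unfinished_def represents_def)
  have "represents ps (v # Q) (den prepend_vertex s)"
    using s v seg partial_cover_prepend[OF D(1) v(2,3) cheap] unfolding s'
    by (auto simp: represents_def unfinished_def frame tour)
  then show ?thesis
    using D by (auto simp: finished_def s' frame intro!: exI[of _ ps] exI[of _ "v # Q"])
qed

lemma unfinished_rotate_path:
  assumes s: "unfinished m ps Q s" and cl: "closable (cheap c) Q"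
  shows "unfinished m ps (last Q # butlast Q) (den rotate_path s)"
proof -
  note D = unfinishedD[OF s]
  define s1 where "s1 = den (Assign ''x'' (Lit 0) last_vertex) s"
  define s2 where "s2 = den (shift 0) s1"
  have s': "den rotate_path s = s2" by (simp add: rotate_path_def s2_def s1_def)
  have len: "s1 ''s'' 0 < s1 ''m'' 0 + 0" "s1 ''m'' 0 + 0 \<le> s1 ''n'' 0"
    using s D(7) by (auto simp: s1_def unfinished_def represents_def)
  have frame: "s2 a = s a" if "a \<notin> {''p'', ''x'', ''y'', ''tour''}" for a
    using den_shift(1)[where k = 0 and s = s1, OF len that] that by (simp add: s2_def s1_def)
  have tour: "s2 ''tour'' i = (if s ''s'' 0 \<le> i \<and> i < m
      then if i = s ''s'' 0 then last Q else s ''tour'' (i - 1) else s ''tour'' i)" for i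
    using den_shift(2)[where k = 0 and s = s1, OF len, of i] D(3,9) by (simp add: s2_def s1_def)
  have seg: "s2 ''tour'' (length (concat ps) + i) = (last Q # butlast Q) ! i" if "i < length Q" for i
    using that s D(6) by (cases i) (auto simp: tour unfinished_def represents_def nth_butlast)
  have "represents ps (last Q # butlast Q) s2"
    using s seg D(7) set_rotate_path[OF D(7)] partial_cover_rotate[OF D(1) cl]
    by (auto simp: represents_def unfinished_def frame tour simp del: set_simps)
  then show ?thesis
    using D by (auto simp: unfinished_def s' frame)
qed

section \<open>Search loops and complete rounds\<close>

lemma finished_skip: "finished m s \<Longrightarrow> den (If (Times pending b) p Nop) s = s"
  by (simp add: finished_def pending_def)

lemma finished_try_vertices:
  assumes wf: "wf_prog (try_vertices b p)" and s: "finished m s"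
  shows "finished m (den (try_vertices b p) s)"
proof -
  have "(\<lambda>_. finished m) (s ''n'' 0) (den (try_vertices b p) s)"
    unfolding try_vertices_def
  proof (rule den_For_rule)
    fix s' assume "finished m s'"
    then show "finished m (set_var ''v'' (Suc i) (den (If (Times pending
        (Times (Eq (Cell ''used'' (var ''v'')) (Lit 0)) b)) p Nop) s'))" for i
      by (simp add: finished_set_var finished_skip del: den.simps)
  qed (use s wf in \<open>simp_all add: finished_set_var try_vertices_def\<close>)
  then show ?thesis .
qed

lemma den_try_vertices:
  assumes wf: "wf_prog (try_vertices b p)" and s: "unfinished m ps Q s"
    and b: "\<And>s' v. unfinished m ps Q s' \<Longrightarrow> v < n \<Longrightarrow> s' ''v'' 0 = v \<Longrightarrow> val b s' \<noteq> 0 \<longleftrightarrow> C v"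
    and p: "\<And>s' v. unfinished m ps Q s' \<Longrightarrow> v < n \<Longrightarrow> s' ''v'' 0 = v \<Longrightarrow>
      v \<notin> set (concat ps @ Q) \<Longrightarrow> C v \<Longrightarrow> finished m (den p s')"
  shows "finished m (den (try_vertices b p) s) \<or> unfinished m ps Q (den (try_vertices b p) s) \<and>
    (\<forall>v<n. v \<notin> set (concat ps @ Q) \<longrightarrow> \<not> C v)"
proof -
  define I where "I = (\<lambda>i s'. finished m s' \<or> unfinished m ps Q s' \<and>
    (\<forall>v<i. v \<notin> set (concat ps @ Q) \<longrightarrow> \<not> C v))"
  have "I (s ''n'' 0) (den (try_vertices b p) s)"
    unfolding try_vertices_def
  proof (rule den_For_rule)
    show "I 0 (set_var ''v'' 0 s)" using s by (simp add: I_def unfinished_set_var)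
  next
    fix i s'
    assume i: "i < s ''n'' 0" "s' ''v'' 0 = i" and I: "I i s'"
    let ?s = "den (If (Times pending (Times (Eq (Cell ''used'' (var ''v'')) (Lit 0)) b)) p Nop) s'"
    have "I (Suc i) ?s"
    proof (cases "finished m s'")
      case True
      then have "finished m ?s" by (simp add: finished_skip del: den.simps)
      then show ?thesis by (simp add: I_def)
    next
      case False
      with I have s': "unfinished m ps Q s'" and C: "\<forall>v<i. v \<notin> set (concat ps @ Q) \<longrightarrow> \<not> C v"
        by (auto simp: I_def)
      have i': "i < n" using i s by (simp add: unfinishedD)
      have val: "val (Times pending (Times (Eq (Cell ''used'' (var ''v'')) (Lit 0)) b)) s' \<noteq> 0
          \<longleftrightarrow> i \<notin> set (concat ps @ Q) \<and> C i"
        using b[OF s' i' i(2)] unfinishedD(4,14)[OF s'] i' i(2) by (simp add: pending_def)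
      show ?thesis
      proof (cases "i \<notin> set (concat ps @ Q) \<and> C i")
        case True
        with val have "?s = den p s'" by (simp del: val.simps)
        with p[OF s' i' i(2)] True show ?thesis by (simp add: I_def)
      next
        case False
        with val have "val (Times pending (Times (Eq (Cell ''used'' (var ''v'')) (Lit 0)) b)) s' = 0"
          by blast
        then have "?s = s'" by (simp del: val.simps)
        with False s' C show ?thesis by (auto simp: I_def less_Suc_eq)
      qed
    qed
    then show "I (Suc i) (set_var ''v'' (Suc i) ?s)"
      by (simp add: I_def unfinished_set_var finished_set_var del: den.simps)
  qed (use wf in \<open>simp add: try_vertices_def\<close>)
  then show ?thesis using unfinishedD(2)[OF s] by (simp add: I_def)
qed

lemma den_try_rotations:
  assumes s: "unfinished m ps Q s"
  shows "finished m (den try_rotations s) \<or> (\<exists>Q. unfinished m ps Q (den try_rotations s) \<and>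
    (\<forall>v<n. v \<notin> set (concat ps @ Q) \<longrightarrow>
      (if closable (cheap c) Q then \<forall>u\<in>set Q. \<not> cheap c u v else \<not> cheap c (last Q) v)))"
proof -
  text \<open>Rotation moves the vertex just tested to the front, so the tested vertices of a closable
    path form a prefix.\<close>
  define K where "K = (\<lambda>i Q. \<forall>v<n. v \<notin> set (concat ps @ Q) \<longrightarrow>
    (if closable (cheap c) Q then \<forall>u\<in>set (take i Q). \<not> cheap c u v
     else 0 < i \<longrightarrow> \<not> cheap c (last Q) v))"
  define I where "I = (\<lambda>i s'. finished m s' \<or> (\<exists>Q. unfinished m ps Q s' \<and> K i Q))"
  let ?try = "try_vertices (cheap_test last_vertex (var ''v'')) append_vertex"
  have wf: "wf_prog ?try" by (simp add: prog_defs)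
  have n: "s ''n'' 0 = n" using unfinishedD(2)[OF s] .
  have "I (s ''n'' 0) (den try_rotations s)"
    unfolding try_rotations_def
  proof (rule den_For_rule)
    show "I 0 (set_var ''r'' 0 s)" using s by (auto simp: I_def unfinished_set_var K_def)
  next
    fix i s'
    assume I: "I i s'"
    let ?s1 = "den ?try s'"
    let ?s = "den (Then ?try (If (Times pending (cheap_test last_vertex first_vertex)) rotate_path Nop)) s'"
    have s1_finished: "finished m ?s" if "finished m ?s1"
      using that unfolding den.simps(3) by (simp add: finished_skip del: den.simps)
    have "I (Suc i) ?s"
    proof (cases "finished m s' \<or> finished m ?s1")
      case True
      then have "finished m ?s1" using finished_try_vertices[OF wf] by blast
      then show ?thesis using s1_finished by (simp add: I_def)
    next
      case False
      with I obtain Q where s': "unfinished m ps Q s'" and K: "K i Q" by (auto simp: I_def)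
      have "finished m ?s1 \<or> unfinished m ps Q ?s1 \<and>
          (\<forall>v<n. v \<notin> set (concat ps @ Q) \<longrightarrow> \<not> cheap c (last Q) v)"
      proof (rule den_try_vertices[OF wf s'])
        fix s'' v assume s'': "unfinished m ps Q s''" "v < n" "s'' ''v'' 0 = v"
        show "val (cheap_test last_vertex (var ''v'')) s'' \<noteq> 0 \<longleftrightarrow> cheap c (last Q) v"
          using s'' unfinishedD[OF s''(1)] by (intro val_cheap_test) auto
      qed (rule finished_append_vertex)
      with False have s1: "unfinished m ps Q ?s1"
        and tested: "\<forall>v<n. v \<notin> set (concat ps @ Q) \<longrightarrow> \<not> cheap c (last Q) v"
        by auto
      have val: "val (Times pending (cheap_test last_vertex first_vertex)) ?s1 \<noteq> 0
          \<longleftrightarrow> closable (cheap c) Q"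
        using val_cheap_test[of ?s1 last_vertex "last Q" first_vertex "hd Q"] unfinishedD[OF s1]
        by (simp add: pending_def closable_def)
      show ?thesis
      proof (cases "closable (cheap c) Q")
        case True
        let ?Q = "last Q # butlast Q"
        have "?s = den rotate_path ?s1" using val True by (simp del: val.simps)
        then have "unfinished m ps ?Q ?s" using unfinished_rotate_path[OF s1 True] by simp
        \<comment> \<open>The first \<open>Suc i\<close> vertices of the rotated path are the one
          just tested and vertices among the old first \<open>i\<close>.\<close>
        moreover have "K (Suc i) ?Q"
        proof -
          have "set (take i (butlast Q)) \<subseteq> set (take i Q)"
            by (auto simp: take_butlast[symmetric] butlast_conv_take min_def
                dest: in_set_takeD set_take_subset_set_take[THEN subsetD, rotated])
          moreover have "closable (cheap c) ?Q"
            using closable_rotate(2)[OF _ _ True] partial_coverD(1,2) unfinishedD(1)[OF s1] by blast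
          moreover have "set (concat ps @ ?Q) = set (concat ps @ Q)"
            using set_rotate_path[OF unfinishedD(7)[OF s1]] by simp
          ultimately show ?thesis
            using K tested True unfolding K_def by (auto simp del: set_append)
        qed
        ultimately show ?thesis unfolding I_def by blast
      next
        case False
        with val have "?s = ?s1" by (simp del: val.simps)
        with s1 have "unfinished m ps Q ?s" by simp
        moreover have "K (Suc i) Q" using tested False by (auto simp: K_def)
        ultimately show ?thesis unfolding I_def by blast
      qed
    qed
    then show "I (Suc i) (set_var ''r'' (Suc i) ?s)"
      by (simp add: I_def unfinished_set_var finished_set_var del: den.simps)
  qed (simp add: prog_defs)
  \<comment> \<open>With at most \<open>m < n\<close> vertices on the path, the tested prefix is the
    whole path after \<open>n\<close> rounds.\<close>
  moreover have "take n Q = Q" if "unfinished m ps Q s'" for Q s'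
    using unfinishedD(5,6)[OF that] by simp
  moreover have "0 < n" using unfinishedD(5)[OF s] by simp
  ultimately show ?thesis unfolding I_def K_def n by metis
qed

lemma finished_try_rotations:
  assumes "finished m s"
  shows "finished m (den try_rotations s)"
proof -
  let ?try = "try_vertices (cheap_test last_vertex (var ''v'')) append_vertex"
  have wf: "wf_prog ?try" by (simp add: prog_defs)
  have "(\<lambda>_. finished m) (s ''n'' 0) (den try_rotations s)"
    unfolding try_rotations_def
  proof (rule den_For_rule)
    fix s' assume "finished m s'"
    then have "finished m (den ?try s')" by (rule finished_try_vertices[OF wf])
    then show "finished m (set_var ''r'' (Suc i) (den (Then ?try
        (If (Times pending (cheap_test last_vertex first_vertex)) rotate_path Nop)) s'))" for i
      unfolding den.simps(3) by (simp add: finished_set_var finished_skip del: den.simps)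
  qed (use assms in \<open>simp_all add: finished_set_var prog_defs\<close>)
  then show ?thesis .
qed

text \<open>Failure of appending, over all rotations, and then of prepending makes \<open>Q\<close>
  exhausted, so a new path may be started. A state that is finished on entry occurs in round
  \<open>0\<close>.\<close>

lemma finished_add_vertex:
  assumes "finished m s \<or> (\<exists>ps Q. unfinished m ps Q s)"
  shows "finished m (den add_vertex s)"
proof -
  let ?pre = "try_vertices (cheap_test (var ''v'') first_vertex) prepend_vertex"
  let ?new = "try_vertices (Lit 1) new_path"
  define s1 s2 where "s1 = den try_rotations s" and "s2 = den ?pre s1"
  have wf: "wf_prog ?pre" "wf_prog ?new" by (simp_all add: prog_defs)
  have "finished m (den ?new s2)"
  proof (cases "finished m s1 \<or> finished m s2")
    case True
    then have "finished m s2" unfolding s2_def using finished_try_vertices[OF wf(1)] by blast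
    then show ?thesis by (rule finished_try_vertices[OF wf(2)])
  next
    case False
    then have "\<not> finished m s" unfolding s1_def using finished_try_rotations by blast
    with assms obtain ps Q0 where "unfinished m ps Q0 s" by blast
    from den_try_rotations[OF this] False obtain Q where s1: "unfinished m ps Q s1" and
      tested: "\<And>v. v < n \<Longrightarrow> v \<notin> set (concat ps @ Q) \<Longrightarrow>
        if closable (cheap c) Q then \<forall>u\<in>set Q. \<not> cheap c u v else \<not> cheap c (last Q) v"
      unfolding s1_def by blast
    have "finished m (den ?pre s1) \<or> unfinished m ps Q (den ?pre s1) \<and>
        (\<forall>v<n. v \<notin> set (concat ps @ Q) \<longrightarrow> \<not> cheap c v (hd Q))"
    proof (rule den_try_vertices[OF wf(1) s1])
      fix s' v assume s': "unfinished m ps Q s'" "v < n" "s' ''v'' 0 = v"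
      show "val (cheap_test (var ''v'') first_vertex) s' \<noteq> 0 \<longleftrightarrow> cheap c v (hd Q)"
        using s' unfinishedD[OF s'(1)] by (intro val_cheap_test) auto
    qed (rule finished_prepend_vertex)
    with False have s2: "unfinished m ps Q s2" and
      tested': "\<And>v. v < n \<Longrightarrow> v \<notin> set (concat ps @ Q) \<Longrightarrow> \<not> cheap c v (hd Q)"
      unfolding s2_def by auto
    have ex: "exhausted (cheap c) Q v" if "v < n" "v \<notin> set (concat ps @ Q)" for v
      using tested[OF that] tested'[OF that] by (simp add: exhausted_def split: if_splits)
    have "finished m (den ?new s2) \<or> unfinished m ps Q (den ?new s2) \<and>
        (\<forall>v<n. v \<notin> set (concat ps @ Q) \<longrightarrow> \<not> True)"
      by (rule den_try_vertices[OF wf(2) s2]) (auto intro: finished_new_path ex)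
    moreover have "\<exists>v<n. v \<notin> set (concat ps @ Q)"
    proof (rule ccontr)
      assume "\<not> ?thesis"
      then have "{..<n} \<subseteq> set (concat ps @ Q)" by auto
      then have "n \<le> card (set (concat ps @ Q))" by (metis List.finite_set card_lessThan card_mono)
      also have "\<dots> \<le> m"
        using card_length[of "concat ps @ Q"] unfinishedD(6)[OF s2] by simp
      finally show False using unfinishedD(5)[OF s2] by simp
    qed
    ultimately show ?thesis by blast
  qed
  then show ?thesis by (simp add: add_vertex_def s1_def s2_def)
qed

lemma greedy_correct:
  assumes "s ''n'' 0 = n" "2 \<le> n" "s ''tour'' 0 = 0" "s ''s'' 0 = 0"
    and "\<And>v. s ''used'' v = 0"
    and "\<And>u v. u < n \<Longrightarrow> v < n \<Longrightarrow> s ''cost'' (u * n + v) = 1 \<longleftrightarrow> cheap c u v"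
  shows "\<exists>ps. greedy_paths (cheap c) ps \<and> set (concat ps) = {..<n} \<and> distinct (concat ps) \<and>
    output_tour n (den greedy s) = concat ps"
proof -
  define s0 where "s0 = den (Assign ''used'' (Lit 0) (Lit 1)) s"
  let ?body = "Then (Assign ''done'' (Lit 0) (Eq (var ''m'') (Lit 0))) add_vertex"
  \<comment> \<open>Vertex \<open>0\<close> is placed before the loop, so rounds \<open>0\<close>
    and \<open>1\<close> both start with one vertex.\<close>
  define I where "I = (\<lambda>i s'. \<exists>ps Q. represents ps Q s' \<and> length (concat ps @ Q) = max 1 i)"
  have n0: "s0 ''n'' 0 = n" using assms by (simp add: s0_def)
  have "I (s0 ''n'' 0) (den (For ''m'' ?body) s0)"
  proof (rule den_For_rule)
    show "wf_prog (For ''m'' ?body)" by (simp add: prog_defs)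
    \<comment> \<open>The path \<open>[0]\<close> is already in memory: cell \<open>0\<close> of
      \<open>tour\<close> and the start index \<open>s\<close> are zero initially.\<close>
    have "represents [] [0] (set_var ''m'' 0 s0)"
      using assms
      by (auto simp: represents_def partial_cover_def greedy_paths_def disjoint_paths_def
          set_var_def s0_def)
    then show "I 0 (set_var ''m'' 0 s0)"
      unfolding I_def by (intro exI[of _ "[]"] exI[of _ "[0]"]) simp
  next
    fix i s'
    assume i: "i < s0 ''n'' 0" "s' ''m'' 0 = i" and "I i s'"
    then obtain ps Q where s': "represents ps Q s'" "length (concat ps @ Q) = max 1 i"
      by (auto simp: I_def)
    let ?s1 = "den (Assign ''done'' (Lit 0) (Eq (var ''m'') (Lit 0))) s'"
    have "represents ps Q ?s1"
      using s'(1) by (subst represents_cong[of _ s']) auto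
    then have "finished i ?s1 \<or> unfinished i ps Q ?s1"
      using s' i n0 by (cases i) (auto simp: finished_def unfinished_def represents_def)
    then have "finished i (den add_vertex ?s1)" by (intro finished_add_vertex) blast
    then obtain ps' Q' where
      "represents ps' Q' (den add_vertex ?s1)" "length (concat ps' @ Q') = Suc i"
      by (auto simp: finished_def)
    then show "I (Suc i) (set_var ''m'' (Suc i) (den ?body s'))"
      unfolding I_def by (intro exI[of _ ps'] exI[of _ Q']) (simp add: represents_set_var)
  qed
  then obtain ps Q where rep: "represents ps Q (den greedy s)" and
    len: "length (concat ps @ Q) = n"
    using n0 assms(2) by (auto simp: I_def greedy_def s0_def max_def)
  have pc: "partial_cover ps Q" using rep by (simp add: represents_def)
  let ?vs = "concat (ps @ [Q])"
  have len': "length ?vs = n" using len by simp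
  have dist: "distinct ?vs" and sub: "set ?vs \<subseteq> {..<n}"
    using pc partial_coverD(6)[OF pc] by (simp_all add: partial_cover_def)
  have "card (set ?vs) = card {..<n}" using distinct_card[OF dist] len' by simp
  then have "set ?vs = {..<n}" using sub by (intro card_subset_eq) auto
  moreover have "output_tour n (den greedy s) = ?vs"
  proof (rule nth_equalityI)
    show "length (output_tour n (den greedy s)) = length ?vs"
      using len' by (simp add: output_tour_def)
    fix i assume "i < length (output_tour n (den greedy s))"
    then have i: "i < n" by (simp add: output_tour_def)
    have "den greedy s ''tour'' i = (concat ps @ Q) ! i"
      using i len by (intro represents_tour[OF rep]) simp
    then show "output_tour n (den greedy s) ! i = ?vs ! i"
      using i by (simp add: output_tour_def)
  qed
  ultimately show ?thesis using pc dist unfolding partial_cover_def by blast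
qed

end

text \<open>Diagonal entries are \<open>0\<close>, so testing a matrix entry for \<open>1\<close>
  decides \<open>cheap c\<close>.\<close>

lemma input_state_cost:
  assumes "u < n" "v < n"
  shows "input_state n c ''cost'' (u * n + v) = (if u = v then 0 else c (u, v))"
proof -
  have "u * n + v < Suc u * n" using assms by simp
  also have "\<dots> \<le> n * n" using assms by (intro mult_le_mono1) simp
  finally show ?thesis using assms by (simp add: input_state_def)
qed

lemma input_state_bounded:
  assumes "atsp12_instance {..<n} c"
  shows "bounded_by (n + 2) (input_state n c)"
proof -
  have "c (i div n, i mod n) \<le> n + 2" if "i < n * n" "i div n \<noteq> i mod n" for i
  proof -
    have "0 < n" using that(1) by (cases n) auto
    then have "(i div n, i mod n) \<in> arcs {..<n}"
      using that by (simp add: arcs_def less_mult_imp_div_less)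
    with assms show ?thesis by (fastforce simp: atsp12_instance_def)
  qed
  then show ?thesis by (auto simp: bounded_by_def input_state_def)
qed

theorem theorem5:
  shows "\<exists>(alg :: com) (q :: nat poly). \<forall>(n :: nat) (c :: nat \<times> nat \<Rightarrow> nat).
    atsp12_instance {..<n} c \<longrightarrow>
      (\<exists>t s. exec alg (input_state n c) t s \<and> t \<le> poly q n \<and>
        hamiltonian_cycle {..<n} (output_tour n s) \<and>
        real (tour_cost c (output_tour n s)) \<le> 3 / 2 * Opt_SER_plus {..<n} c)"
proof -
  obtain q where q: "\<And>s B. bounded_by B s \<Longrightarrow>
      \<exists>t \<le> poly q B. exec (compile greedy) s t (den greedy s)"
    using compile_poly_time[OF wf_greedy] by blast
  \<comment> \<open>Cells of the input are at most \<open>n + 2\<close>, so the running time is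
    bounded by \<open>q\<close> evaluated at \<open>n + 2\<close>.\<close>
  show ?thesis
  proof (rule exI[of _ "compile greedy"], rule exI[of _ "pcompose q [:2, 1:]"],
      intro allI impI)
    fix n :: nat and c :: "nat \<times> nat \<Rightarrow> nat"
    assume inst: "atsp12_instance {..<n} c"
    let ?s = "den greedy (input_state n c)"
    obtain t where t: "t \<le> poly q (n + 2)" "exec (compile greedy) (input_state n c) t ?s"
      using q[OF input_state_bounded[OF inst]] by blast
    have n2: "2 \<le> n" using inst by (simp add: atsp12_instance_def)
    have "\<exists>ps. greedy_paths (cheap c) ps \<and> set (concat ps) = {..<n} \<and> distinct (concat ps) \<and>
        output_tour n ?s = concat ps"
      using n2 by (intro greedy_correct)
        (simp_all add: input_state_cost cheap_def, simp_all add: input_state_def)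
    then obtain ps where ps: "greedy_paths (cheap c) ps" "set (concat ps) = {..<n}"
      "distinct (concat ps)" "output_tour n ?s = concat ps"
      by blast
    have "hamiltonian_cycle {..<n} (output_tour n ?s)"
      unfolding hamiltonian_cycle_def ps(4) using ps(2,3) by blast
    moreover have "t \<le> poly (pcompose q [:2, 1:]) n"
      using t(1) by (simp add: poly_pcompose add.commute)
    moreover have "real (tour_cost c (output_tour n ?s)) \<le> 3 / 2 * Opt_SER_plus {..<n} c"
      unfolding ps(4) by (rule greedy_paths_tour_cost_Opt[OF inst ps(1,2)])
    ultimately show "\<exists>t s. exec (compile greedy) (input_state n c) t s \<and>
        t \<le> poly (pcompose q [:2, 1:]) n \<and>
        hamiltonian_cycle {..<n} (output_tour n s) \<and>
        real (tour_cost c (output_tour n s)) \<le> 3 / 2 * Opt_SER_plus {..<n} c"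
      using t(2) by blast
  qed
qed

end
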